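(* Let $d\ge 2$, $1\le q<d$, $0<\delta<1$, $\nu\in(0,1]$. Let $a^{ij}=a^{ji}$ ($i,j=1,\dots,d$) be constants satisfying $\nu|\xi|^2\le a^{ij}\xi^i\xi^j\le\nu^{-1}|\xi|^2$ for all $\xi\in\mathbb{R}^d$, and let $L_0u:=a^{ij}D_{ij}u$. Let $f\in C^{\delta}_{x'}(\mathbb{R}^d)$ and let $u$ be a bounded $W^2_{2,\mathrm{loc}}(\mathbb{R}^d)$ solution of $L_0u=f$ in $\mathbb{R}^d$. Then $D_{x'}u\in C^{1+\delta}(\mathbb{R}^d)$ and there is a constant $N=N(d,q,\delta,\nu)$ such that \[ [D_{x'}u]_{1+\delta}\le N[f]_{x',\delta}. \]
   Context: Points of $\mathbb{R}^d$ are written $x=(x',x'')$ with $x'=(x^1,\dots,x^q)$, $x''=(x^{q+1},\dots,x^d)$. $[f]_{x',\delta}:=\sup_{x''}\sup_{x'\ne y'}\frac{|f(x',x'')-f(y',x'')|}{|x'-y'|^\delta}$, and $C^\delta_{x'}(\mathbb{R}^d)$ is the set of bounded measurable $f$ with $[f]_{x',\delta}<\infty$. $D_{x'}u=(D_1u,\dots,D_qu)$. For a function $g$ on $\mathbb{R}^d$, $[g]_{1+\delta}:=[Dg]_\delta:=\max_{1\le i\le d}\sup_{x\ne y}\frac{|D_ig(x)-D_ig(y)|}{|x-y|^\delta}$ (usual Hölder semi-norm in all variables), $[D_{x'}u]_{1+\delta}:=\max_{1\le j\le q}[D_ju]_{1+\delta}$, and $D_{x'}u\in C^{1+\delta}(\mathbb{R}^d)$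 means each $D_ju$, $j\le q$, is continuously differentiable with this semi-norm finite. *)

theory Defs
  imports "HOL-Analysis.Analysis"
begin

text \<open>Points of R^d are vectors of type real^'n with d = CARD('n).
  The coordinates x' are those indexed by a set Q of q indices, x'' the others.\<close>

definition partial :: "'n::finite \<Rightarrow> (real^'n \<Rightarrow> real) \<Rightarrow> real^'n \<Rightarrow> real" where
  "partial i g x = frechet_derivative g (at x) (axis i 1)"

fun higher_partial :: "'n::finite list \<Rightarrow> (real^'n \<Rightarrow> real) \<Rightarrow> real^'n \<Rightarrow> real" where
  "higher_partial [] g = g"
| "higher_partial (i # is) g = partial i (higher_partial is g)"

definition smooth_fun :: "(real^'n::finite \<Rightarrow> real) \<Rightarrow> bool" where
  "smooth_fun g \<longleftrightarrow> (\<forall>is. (\<forall>x. higher_partial is g differentiable (at x))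
                          \<and> continuous_on UNIV (higher_partial is g))"

definition test_fun :: "(real^'n::finite \<Rightarrow> real) \<Rightarrow> bool" where
  "test_fun g \<longleftrightarrow> smooth_fun g \<and> compact (closure {x. g x \<noteq> 0})"

definition loc_integrable :: "(real^'n::finite \<Rightarrow> real) \<Rightarrow> bool" where
  "loc_integrable g \<longleftrightarrow> (\<forall>K. compact K \<longrightarrow> set_integrable lebesgue K g)"

definition L2_loc :: "(real^'n::finite \<Rightarrow> real) \<Rightarrow> bool" where
  "L2_loc g \<longleftrightarrow> g \<in> borel_measurable lebesgue \<and>
     (\<forall>K. compact K \<longrightarrow> set_integrable lebesgue K (\<lambda>x. (g x)\<^sup>2))"

definition weak_deriv1 :: "'n::finite \<Rightarrow> (real^'n \<Rightarrow> real) \<Rightarrow> (real^'n \<Rightarrow> real) \<Rightarrow> bool" where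
  "weak_deriv1 i u v \<longleftrightarrow> (\<forall>\<phi>. test_fun \<phi> \<longrightarrow>
     integral\<^sup>L lebesgue (\<lambda>x. u x * partial i \<phi> x) = - integral\<^sup>L lebesgue (\<lambda>x. v x * \<phi> x))"

definition weak_deriv2 :: "'n::finite \<Rightarrow> 'n \<Rightarrow> (real^'n \<Rightarrow> real) \<Rightarrow> (real^'n \<Rightarrow> real) \<Rightarrow> bool" where
  "weak_deriv2 i j u w \<longleftrightarrow> (\<forall>\<phi>. test_fun \<phi> \<longrightarrow>
     integral\<^sup>L lebesgue (\<lambda>x. u x * partial i (partial j \<phi>) x) = integral\<^sup>L lebesgue (\<lambda>x. w x * \<phi> x))"

definition W22_loc_with :: "(real^'n::finite \<Rightarrow> real) \<Rightarrow> ('n \<Rightarrow> real^'n \<Rightarrow> real)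
     \<Rightarrow> ('n \<Rightarrow> 'n \<Rightarrow> real^'n \<Rightarrow> real) \<Rightarrow> bool" where
  "W22_loc_with u g1 g2 \<longleftrightarrow> L2_loc u \<and> loc_integrable u \<and>
     (\<forall>i. L2_loc (g1 i) \<and> weak_deriv1 i u (g1 i)) \<and>
     (\<forall>i j. L2_loc (g2 i j) \<and> weak_deriv2 i j u (g2 i j))"

definition holder_x' :: "'n::finite set \<Rightarrow> real \<Rightarrow> (real^'n \<Rightarrow> real) \<Rightarrow> real" where
  "holder_x' Q \<delta> f = Sup {\<bar>f x - f y\<bar> / norm (x - y) powr \<delta> | x y.
       x \<noteq> y \<and> (\<forall>i. i \<notin> Q \<longrightarrow> x $ i = y $ i)}"

definition holder_x'_finite :: "'n::finite set \<Rightarrow> real \<Rightarrow> (real^'n \<Rightarrow> real) \<Rightarrow> bool" where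
  "holder_x'_finite Q \<delta> f \<longleftrightarrow> (\<exists>C. \<forall>x y. (\<forall>i. i \<notin> Q \<longrightarrow> x $ i = y $ i) \<longrightarrow>
       \<bar>f x - f y\<bar> \<le> C * norm (x - y) powr \<delta>)"

definition C_delta_x' :: "'n::finite set \<Rightarrow> real \<Rightarrow> (real^'n \<Rightarrow> real) \<Rightarrow> bool" where
  "C_delta_x' Q \<delta> f \<longleftrightarrow> f \<in> borel_measurable lebesgue \<and> bounded (range f) \<and> holder_x'_finite Q \<delta> f"

end

theory Submission
  imports Defs
begin

text \<open>
  Let \<open>b\<close> be the inverse matrix of \<open>a\<close> and put \<open>\<psi>(z) = \<Phi>(1 - bz\<cdot>z/2)\<close>, \<open>\<eta>(z) = \<Phi>'(1 - bz\<cdot>z/2)\<close>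
  for a smooth function \<open>\<Phi>\<close> vanishing on the negative half-line. Then \<open>d \<eta> + z\<cdot>\<nabla>\<eta> = - L\<^sub>0 \<psi>\<close>, so
  the mollifications with \<open>\<eta>\<^sub>R(z) = \<eta>(z/R) / R\<^sup>d\<close> satisfy
  \<open>\<partial>\<^sub>R (u * \<partial>\<^sup>\<alpha>\<eta>\<^sub>R) = R (f * \<partial>\<^sup>\<alpha>\<psi>\<^sub>R)\<close> (a compactly supported analogue of the heat semigroup).
  If \<open>\<alpha>\<close> contains a direction \<open>j\<close> in which \<open>f\<close> is Hoelder continuous, the right-hand side is of size
  \<open>R powr (1 + \<delta> - |\<alpha>|)\<close>. This is integrable at \<open>R = 0\<close> for \<open>|\<alpha>| \<le> 2\<close>, which gives uniform convergence of
  \<open>D\<^sub>j u\<^sub>R\<close> and of its gradient, and integrable at \<open>R = \<infinity>\<close> for \<open>|\<alpha>| = 3\<close>, which bounds the second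
  derivatives of \<open>D\<^sub>j u\<^sub>R\<close> by a multiple of \<open>R powr (\<delta> - 1)\<close>. Comparing two points at the scale \<open>R = |x - y|\<close> gives the estimate.
\<close>

section \<open>Smooth functions and test functions\<close>

text \<open>The kernel identity is a divergence in disguise: grad \<psi> = - \<eta> b z and
  \<open>b\<close> inverts \<open>a\<close>, hence a grad \<psi> = - z \<eta>, whose divergence is
  L0 \<psi>. It brings in the equation with kernels of compact support, so that every rescaled
  kernel is an admissible test function for the weak derivatives. One index j among the derivatives
  is enough, because a j-th derivative of a kernel integrates to zero along lines parallel to the
  j-th axis; the other derivatives are arbitrary. So all second derivatives D_i D_j u are controlled
  although \<open>f\<close> may be rough in x''. For three derivatives the comparison starts at
  infinite R, where boundedness of \<open>u\<close> makes the mollification vanish; this is why no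
  norm of \<open>u\<close> survives in the estimate. The choice \<Phi>(t) = exp (-1/t) serves the
  formal notion of smoothness: together with the factors \<open>1 / t ^ n\<close> it gives a family
  closed under differentiation, so that iterated partial derivatives are handled by structural
  induction. The mass of \<eta> depends on \<open>a\<close>; it is divided out at the end, with a
  lower bound that depends only on d and \<nu>.\<close>

definition flat :: "nat \<Rightarrow> real \<Rightarrow> real" where
  "flat n t = (if 0 < t then exp (- (1 / t)) / t ^ n else 0)"

lemma flat_nonneg [simp]: "0 \<le> flat n t"
  by (simp add: flat_def)

lemma flat_eq_0 [simp]: "t \<le> 0 \<Longrightarrow> flat n t = 0"
  by (simp add: flat_def)

text \<open>One term of the series of \<open>exp (1 / t)\<close>, the one of index
  \<open>n + 2\<close>, already beats \<open>1 / t ^ n\<close> by a factor of order two. Quadratic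
  decay is what makes the derivative at 0 vanish.\<close>

lemma flat_le_square: "flat n t \<le> fact (n + 2) * t\<^sup>2"
proof (cases "0 < t")
  case True
  define F :: real where "F = fact (n + 2)"
  have F: "0 < F * t ^ (n + 2)"
    using True by (simp add: F_def)
  have "sum (\<lambda>k. (1 / t) ^ k /\<^sub>R fact k) {n + 2} \<le> exp (1 / t)"
    unfolding exp_def using True summable_exp_generic[of "1 / t"] by (intro sum_le_suminf) auto
  then have "1 / (F * t ^ (n + 2)) \<le> exp (1 / t)"
    unfolding F_def by (simp add: divide_inverse power_inverse del: fact_Suc power_Suc add_2_eq_Suc')
  then have "1 \<le> F * t ^ (n + 2) * exp (1 / t)"
    using F by (simp only: pos_divide_le_eq mult.commute)
  also have "F * t ^ (n + 2) * exp (1 / t) = F * t\<^sup>2 * (t ^ n * exp (1 / t))"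
    by (simp only: power_add mult_ac)
  finally have "1 / (t ^ n * exp (1 / t)) \<le> F * t\<^sup>2"
    using True by (subst pos_divide_le_eq) auto
  moreover have "flat n t = 1 / (t ^ n * exp (1 / t))"
    using True by (simp add: flat_def exp_minus divide_inverse)
  ultimately show ?thesis
    by (simp only: F_def)
qed auto

text \<open>Differentiation does not leave the family. The case \<open>n = 0\<close> says that
  \<open>flat 2\<close> is the derivative of \<open>flat 0\<close>; these two are the \<Phi>' and
  \<Phi> of the overview.\<close>

lemma has_real_derivative_flat:
  "(flat n has_real_derivative (flat (n + 2) t - real n * flat (n + 1) t)) (at t)"
proof -
  consider "0 < t" | "t < 0" | "t = 0" by linarith
  then show ?thesis
  proof cases
    case 1
    have "((\<lambda>t. exp (- (1 / t)) * inverse t ^ n) has_real_derivative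
        exp (- (1 / t)) * inverse t ^ (n + 2) - real n * (exp (- (1 / t)) * inverse t ^ (n + 1))) (at t)"
    \<comment> \<open>The power rule produces the natural-number exponent \<open>n - 1\<close>, so
      \<open>n = 0\<close> is treated apart.\<close>
    proof (cases "n = 0")
      case True
      have "((\<lambda>t. exp (- (1 / t))) has_real_derivative exp (- (1 / t)) * (1 / t)\<^sup>2) (at t)"
        using 1 by (auto intro!: derivative_eq_intros simp: power2_eq_square)
      with True show ?thesis
        by (simp add: divide_inverse power2_eq_square)
    next
      case False
      then show ?thesis
        using 1 by (auto intro!: derivative_eq_intros
            simp: power2_eq_square algebra_simps divide_inverse simp flip: power_Suc)
    qed
    then have "((\<lambda>t. exp (- (1 / t)) / t ^ n) has_real_derivative
        (flat (n + 2) t - real n * flat (n + 1) t)) (at t)"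
      using 1 by (simp only: flat_def divide_inverse power_inverse if_True)
    moreover have "\<forall>\<^sub>F s in nhds t. exp (- (1 / s)) / s ^ n = flat n s"
      using 1 by (intro eventually_mono[OF eventually_nhds_in_open[of "{0<..}"]]) (auto simp: flat_def)
    ultimately show ?thesis
      by (simp only: DERIV_cong_ev[OF refl _ refl])
  next
    case 2
    have "((\<lambda>t. 0) has_real_derivative (flat (n + 2) t - real n * flat (n + 1) t)) (at t)"
      using 2 by simp
    moreover have "\<forall>\<^sub>F s in nhds t. 0 = flat n s"
      using 2 by (intro eventually_mono[OF eventually_nhds_in_open[of "{..<0}"]]) auto
    ultimately show ?thesis
      by (simp only: DERIV_cong_ev[OF refl _ refl])
  next
    case 3
    have "((\<lambda>h. flat n h / h) \<longlongrightarrow> 0) (at 0)"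
    proof (rule Lim_null_comparison)
      show "\<forall>\<^sub>F h in at 0. norm (flat n h / h) \<le> fact (n + 2) * \<bar>h\<bar>"
      proof (rule eventually_at_filter[THEN iffD2, OF always_eventually], clarify)
        fix h :: real assume "h \<noteq> 0"
        then show "norm (flat n h / h) \<le> fact (n + 2) * \<bar>h\<bar>"
          using flat_le_square[of n h]
          by (simp add: divide_le_eq mult.assoc flip: abs_mult power2_eq_square)
      qed
      show "((\<lambda>h. fact (n + 2) * \<bar>h\<bar>) \<longlongrightarrow> 0) (at (0::real))"
        by (auto intro!: tendsto_eq_intros)
    qed
    then show ?thesis
      using 3 by (simp add: DERIV_def)
  qed
qed

section \<open>Functions smooth in the point and continuous in a parameter\<close>

text \<open>The parameter will be the matrix \<open>b\<close>: joint continuity of all derivatives in parameter and point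
  makes the kernel bounds uniform over the compact set of admissible matrices.\<close>

inductive smooth_family :: "('p::topological_space \<Rightarrow> real^'n::finite \<Rightarrow> real) \<Rightarrow> bool" where
  const: "continuous_on UNIV c \<Longrightarrow> smooth_family (\<lambda>p x. c p)"
| coord: "smooth_family (\<lambda>p x. x $ i)"
| add: "smooth_family G \<Longrightarrow> smooth_family H \<Longrightarrow> smooth_family (\<lambda>p x. G p x + H p x)"
| mult: "smooth_family G \<Longrightarrow> smooth_family H \<Longrightarrow> smooth_family (\<lambda>p x. G p x * H p x)"
| flat: "smooth_family G \<Longrightarrow> smooth_family (\<lambda>p x. flat n (G p x))"

lemma smooth_family_real: "smooth_family (\<lambda>p x. r)"
  by (rule smooth_family.const) auto

lemma smooth_family_diff: "smooth_family G \<Longrightarrow> smooth_family H \<Longrightarrow> smooth_family (\<lambda>p x. G p x - H p x)"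
  using smooth_family.add[of G "\<lambda>p x. (-1) * H p x"] smooth_family.mult[OF smooth_family_real[of "-1"], of H] by simp

lemma smooth_family_sum: "(\<And>i. i \<in> I \<Longrightarrow> smooth_family (G i)) \<Longrightarrow> smooth_family (\<lambda>p x. \<Sum>i\<in>I. G i p x)"
  by (induction I rule: infinite_finite_induct) (auto intro: smooth_family_real smooth_family.add)

lemma smooth_family_prod: "(\<And>i. i \<in> I \<Longrightarrow> smooth_family (G i)) \<Longrightarrow> smooth_family (\<lambda>p x. \<Prod>i\<in>I. G i p x)"
  by (induction I rule: infinite_finite_induct) (auto intro: smooth_family_real smooth_family.mult)

lemma partial_has_derivative: "(g has_derivative g') (at x) \<Longrightarrow> partial i g x = g' (axis i 1)"
  by (simp add: partial_def frechet_derivative_at[symmetric])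

lemma smooth_family_imp_differentiable: "smooth_family G \<Longrightarrow> G p differentiable (at x)"
proof (induction arbitrary: p x rule: smooth_family.induct)
  case (flat G n)
  have "(\<lambda>x. flat n (G p x)) = flat n \<circ> G p" by auto
  then show ?case
    using flat has_real_derivative_flat[of n "G p x"]
    by (metis differentiable_chain_at differentiableI has_field_derivative_imp_has_derivative)
qed (auto intro: bounded_linear_imp_differentiable bounded_linear_vec_nth)

lemma frechet_derivativeI: "g differentiable (at x) \<Longrightarrow> (g has_derivative frechet_derivative g (at x)) (at x)"
  by (simp add: frechet_derivative_works)

lemma partial_const [simp]: "partial i (\<lambda>x. c) = (\<lambda>x. 0)"
  by (auto simp: partial_def)

lemma partial_coord [simp]: "partial i (\<lambda>x. x $ j) = (\<lambda>x. if i = j then 1 else 0)"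
  by (rule ext, subst partial_has_derivative[OF bounded_linear_imp_has_derivative[OF bounded_linear_vec_nth]])
     (auto simp: axis_def)

lemma partial_add: "g differentiable (at x) \<Longrightarrow> h differentiable (at x) \<Longrightarrow>
    partial i (\<lambda>x. g x + h x) x = partial i g x + partial i h x"
  by (subst partial_has_derivative[OF has_derivative_add[OF frechet_derivativeI frechet_derivativeI]])
     (auto simp: partial_def)

lemma partial_mult: "g differentiable (at x) \<Longrightarrow> h differentiable (at x) \<Longrightarrow>
    partial i (\<lambda>x. g x * h x) x = g x * partial i h x + partial i g x * h x"
  by (subst partial_has_derivative[OF has_derivative_mult[OF frechet_derivativeI frechet_derivativeI]])
     (auto simp: partial_def)

lemma partial_compose:
  assumes "g differentiable (at x)" "(F has_real_derivative D) (at (g x))"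
  shows "partial i (\<lambda>x. F (g x)) x = D * partial i g x"
proof -
  have "((\<lambda>x. F (g x)) has_derivative (\<lambda>h. D * frechet_derivative g (at x) h)) (at x)"
    using has_derivative_compose[OF frechet_derivativeI[OF assms(1)] has_field_derivative_imp_has_derivative[OF assms(2)]] .
  then show ?thesis by (simp add: partial_has_derivative partial_def[of i g])
qed

lemma partial_flat: "g differentiable (at x) \<Longrightarrow>
   partial i (\<lambda>x. flat n (g x)) x = (flat (n + 2) (g x) - real n * flat (n + 1) (g x)) * partial i g x"
  by (rule partial_compose[OF _ has_real_derivative_flat])

lemma smooth_family_partial: "smooth_family G \<Longrightarrow> smooth_family (\<lambda>p. partial i (G p))"
proof -
  assume "smooth_family G"
  then have "smooth_family (\<lambda>p x. partial i (G p) x)"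
  proof (induction rule: smooth_family.induct)
    case (add G H)
    then show ?case by (simp add: partial_add smooth_family_imp_differentiable smooth_family.add)
  next
    case (mult G H)
    then show ?case by (simp add: partial_mult smooth_family_imp_differentiable smooth_family.add smooth_family.mult)
  next
    case (flat G n)
    then show ?case
      by (simp add: partial_flat smooth_family_imp_differentiable smooth_family_diff smooth_family.mult smooth_family.flat smooth_family_real)
  qed (auto intro: smooth_family_real)
  then show ?thesis .
qed

text \<open>Induction on the construction replaces the analytic theorem on mixed derivatives. For
  \<open>flat\<close> both orders give the second derivative of \<open>flat n\<close> times the two
  first partials of \<open>G p\<close>, plus the first derivative times a mixed partial that is
  symmetric by the induction hypothesis.\<close>

lemma smooth_family_partial_commute: "smooth_family G \<Longrightarrow> partial i (partial j (G p)) = partial j (partial i (G p))"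
proof (induction rule: smooth_family.induct)
  case (add G H)
  have *: "partial i (\<lambda>x. G p x + H p x) = (\<lambda>x. partial i (G p) x + partial i (H p) x)" for i
    using add by (auto intro!: partial_add smooth_family_imp_differentiable)
  show ?case unfolding * using add
    by (auto simp: fun_eq_iff partial_add smooth_family_imp_differentiable[OF smooth_family_partial] smooth_family_imp_differentiable)
next
  case (mult G H)
  note [simp] = smooth_family_imp_differentiable[OF smooth_family_partial] smooth_family_imp_differentiable
  have *: "partial i (\<lambda>x. G p x * H p x) = (\<lambda>x. G p x * partial i (H p) x + partial i (G p) x * H p x)" for i
    using mult by (auto intro!: partial_mult)
  show ?case unfolding * using mult
    by (auto simp: fun_eq_iff partial_add partial_mult)
next
  case (flat G n)
  note [simp] = smooth_family_imp_differentiable[OF smooth_family_partial] smooth_family_imp_differentiable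
  have *: "partial i (\<lambda>x. flat n (G p x)) = (\<lambda>x. (flat (n + 2) (G p x) - real n * flat (n + 1) (G p x)) * partial i (G p) x)" for i
    using flat by (intro ext partial_flat) auto
  have **: "partial i (\<lambda>x. (flat (n + 2) (G p x) - real n * flat (n + 1) (G p x))) x =
    (flat (n + 4) (G p x) - (2 * real n + 2) * flat (n + 3) (G p x) + real n * (real n + 1) * flat (n + 2) (G p x)) * partial i (G p) x" for i x
    using flat has_real_derivative_flat[of "n+2"] has_real_derivative_flat[of "n+1"]
    by (intro partial_compose) (auto intro!: derivative_eq_intros simp: algebra_simps eval_nat_numeral)
  have "(\<lambda>x. (flat (n + 2) (G p x) - real n * flat (n + 1) (G p x))) differentiable (at x)" for x
    using flat by (intro smooth_family_imp_differentiable[where G="\<lambda>p x. (flat (n + 2) (G p x) - real n * flat (n + 1) (G p x))"]) (auto intro!: smooth_family_diff smooth_family.flat smooth_family.mult smooth_family_real)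
  note diff = this
  show ?case unfolding *
  proof
    fix x
    show "partial i (\<lambda>x. (flat (n + 2) (G p x) - real n * flat (n + 1) (G p x)) * partial j (G p) x) x =
          partial j (\<lambda>x. (flat (n + 2) (G p x) - real n * flat (n + 1) (G p x)) * partial i (G p) x) x"
      unfolding partial_mult[OF diff smooth_family_imp_differentiable[OF smooth_family_partial[OF flat.hyps]]] **
      by (simp add: flat.IH)
  qed
qed auto

lemma smooth_family_higher_partial: "smooth_family G \<Longrightarrow> smooth_family (\<lambda>p. higher_partial is (G p))"
  by (induction "is") (auto intro: smooth_family_partial)

lemma smooth_family_smooth: "smooth_family G \<Longrightarrow> smooth_fun (G p)"
  unfolding smooth_fun_def
  using smooth_family_imp_differentiable[OF smooth_family_higher_partial]
  by (metis continuous_at_imp_continuous_on differentiable_imp_continuous_within)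

lemma smooth_family_continuous: "smooth_family G \<Longrightarrow> continuous_on UNIV (\<lambda>(p, x). G p x)"
proof (induction rule: smooth_family.induct)
  case (flat G n)
  have "continuous_on UNIV (flat n)"
    using has_real_derivative_flat by (intro DERIV_continuous_on) (auto intro: has_field_derivative_at_within)
  then have "continuous_on UNIV (\<lambda>z. flat n ((\<lambda>(p,x). G p x) z))"
    using flat.IH by (rule continuous_on_compose2) auto
  then show ?case by (simp add: case_prod_beta)
qed (auto simp: case_prod_beta intro!: continuous_intros intro: continuous_on_compose2)

section \<open>Gradients, test functions and their affine rescalings\<close>

lemma has_derivative_partial:
  fixes g :: "real^'n::finite \<Rightarrow> real"
  assumes "g differentiable (at x)"
  shows "(g has_derivative (\<lambda>h. \<Sum>i\<in>UNIV. h $ i * partial i g x)) (at x)"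
proof -
  have lin: "linear (frechet_derivative g (at x))"
    using assms by (rule linear_frechet_derivative)
  have "frechet_derivative g (at x) h = (\<Sum>i\<in>UNIV. h $ i * partial i g x)" for h
    unfolding partial_def
    by (subst (1) basis_expansion[of h, symmetric, unfolded scalar_mult_eq_scaleR])
       (simp add: linear_sum[OF lin] linear_scale[OF lin])
  then have "frechet_derivative g (at x) = (\<lambda>h. \<Sum>i\<in>UNIV. h $ i * partial i g x)"
    by (rule ext)
  then show ?thesis
    using frechet_derivativeI[OF assms] by simp
qed

text \<open>The head of the list is differentiated last, so appending an index at the end changes
  the function to which the remaining list is applied. This is how partial derivatives inherit
  smoothness.\<close>

lemma higher_partial_snoc: "higher_partial (is @ [i]) g = higher_partial is (partial i g)"
  by (induction "is") auto

lemma smooth_fun_partial: "smooth_fun g \<Longrightarrow> smooth_fun (partial i g)"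
  by (metis smooth_fun_def higher_partial_snoc)

lemma smooth_fun_differentiable: "smooth_fun g \<Longrightarrow> g differentiable (at x)"
  by (metis smooth_fun_def higher_partial.simps(1))

lemma smooth_fun_continuous: "smooth_fun g \<Longrightarrow> continuous_on UNIV g"
  by (metis smooth_fun_def higher_partial.simps(1))

lemma partial_zero_outside:
  assumes "\<And>z. r < norm z \<Longrightarrow> g z = 0" "r < norm z"
  shows "partial i g z = 0"
proof -
  have "((\<lambda>z. 0) has_derivative (\<lambda>h. 0)) (at z)" by simp
  moreover have "open {z. r < norm z}" by (intro open_Collect_less continuous_intros)
  ultimately have "(g has_derivative (\<lambda>h. 0)) (at z)"
    by (rule has_derivative_transform_within_open[where s="{z. r < norm z}"]) (use assms in auto)
  then show ?thesis by (simp add: partial_has_derivative)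
qed

lemma test_funI:
  assumes "smooth_fun g" "\<And>z. r < norm z \<Longrightarrow> g z = 0"
  shows "test_fun g"
proof -
  have "{z. g z \<noteq> 0} \<subseteq> cball 0 r"
    using assms(2) by (auto simp: not_less[symmetric])
  then show ?thesis
    using assms(1) bounded_subset[OF bounded_cball] by (auto simp: test_fun_def compact_closure)
qed

lemma test_fun_support:
  assumes "test_fun g"
  obtains r where "0 < r" "\<And>z. r < norm z \<Longrightarrow> g z = 0"
proof -
  have "bounded {z. g z \<noteq> 0}"
    using assms by (auto simp: test_fun_def compact_closure)
  then obtain r where "0 < r" "\<And>z. g z \<noteq> 0 \<Longrightarrow> norm z \<le> r"
    by (auto simp: bounded_pos)
  then show thesis by (intro that[of r]) (auto simp: not_le[symmetric])
qed

lemma test_fun_smooth: "test_fun g \<Longrightarrow> smooth_fun g"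
  by (simp add: test_fun_def)

lemmas test_fun_differentiable = smooth_fun_differentiable[OF test_fun_smooth]
lemmas test_fun_continuous = smooth_fun_continuous[OF test_fun_smooth]

lemma test_fun_partial:
  assumes "test_fun g"
  shows "test_fun (partial i g)"
proof -
  obtain r where "0 < r" "\<And>z. r < norm z \<Longrightarrow> g z = 0"
    using test_fun_support[OF assms] by blast
  then show ?thesis
    using assms by (intro test_funI[of _ r]) (auto intro: smooth_fun_partial test_fun_smooth partial_zero_outside)
qed

lemma test_fun_bounded:
  assumes "test_fun g"
  obtains M where "0 < M" "\<And>z. \<bar>g z\<bar> \<le> M"
proof -
  obtain r where r: "0 < r" "\<And>z. r < norm z \<Longrightarrow> g z = 0"
    using test_fun_support[OF assms] by blast
  have "compact (g ` cball 0 r)"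
    by (intro compact_continuous_image continuous_on_subset[OF test_fun_continuous[OF assms]]) auto
  then obtain M where M: "0 < M" "\<And>z. z \<in> cball 0 r \<Longrightarrow> \<bar>g z\<bar> \<le> M"
    using compact_imp_bounded bounded_pos by (metis imageI real_norm_def)
  have "\<bar>g z\<bar> \<le> M" for z
    using M r(2)[of z] by (cases "r < norm z") auto
  with M(1) that show thesis by blast
qed

lemma differentiable_affine:
  fixes g :: "'a::real_normed_vector \<Rightarrow> 'b::real_normed_vector"
  assumes "g differentiable (at (s *\<^sub>R (x - y)))"
  shows "(\<lambda>y. g (s *\<^sub>R (x - y))) differentiable (at y)"
  using assms by (rule differentiable_compose) auto

lemma partial_affine:
  assumes "g differentiable (at (s *\<^sub>R (x - y)))"
  shows "partial i (\<lambda>y. g (s *\<^sub>R (x - y))) y = - s * partial i g (s *\<^sub>R (x - y))"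
proof -
  have "((\<lambda>y. s *\<^sub>R (x - y)) has_derivative (\<lambda>h. s *\<^sub>R (- h))) (at y)"
    by (auto intro!: derivative_eq_intros)
  from has_derivative_compose[OF this frechet_derivativeI[OF assms]]
  have "partial i (\<lambda>y. g (s *\<^sub>R (x - y))) y = frechet_derivative g (at (s *\<^sub>R (x - y))) (s *\<^sub>R (- axis i 1))"
    by (rule partial_has_derivative)
  also have "s *\<^sub>R (- axis i 1) = (- s) *\<^sub>R axis i (1::real)" by simp
  also have "frechet_derivative g (at (s *\<^sub>R (x - y))) \<dots> = - s * partial i g (s *\<^sub>R (x - y))"
    using linear_scale[OF linear_frechet_derivative[OF assms]] by (simp only: partial_def real_scaleR_def)
  finally show ?thesis .
qed

lemma partial_cmult: "g differentiable (at x) \<Longrightarrow> partial i (\<lambda>x. c * g x) x = c * partial i g x"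
  by (simp add: partial_mult)

lemma higher_partial_affine:
  assumes "smooth_fun g"
  shows "higher_partial is (\<lambda>y. g (s *\<^sub>R (x - y))) = (\<lambda>y. (- s) ^ length is * higher_partial is g (s *\<^sub>R (x - y)))"
proof (induction "is")
  case (Cons i "is")
  have d: "higher_partial is g differentiable (at z)" for z
    using assms by (simp add: smooth_fun_def)
  have "(\<lambda>y. higher_partial is g (s *\<^sub>R (x - y))) differentiable (at y)" for y
    using d by (rule differentiable_affine)
  then show ?case
    by (auto simp: Cons partial_cmult partial_affine[OF d])
qed auto

lemma test_fun_affine:
  assumes "test_fun g" "s \<noteq> 0"
  shows "test_fun (\<lambda>y. g (s *\<^sub>R (x - y)))"
proof -
  note sm = test_fun_smooth[OF assms(1)]
  obtain r where r: "0 < r" "\<And>z. r < norm z \<Longrightarrow> g z = 0"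
    using test_fun_support[OF assms(1)] by blast
  have c: "continuous_on UNIV (\<lambda>y. higher_partial is g (s *\<^sub>R (x - y)))"
    and d: "(\<lambda>y. higher_partial is g (s *\<^sub>R (x - y))) differentiable (at y)" for "is" y
    using sm continuous_on_compose2[of UNIV "higher_partial is g" UNIV "\<lambda>y. s *\<^sub>R (x - y)"]
    by (auto simp: smooth_fun_def continuous_on_scaleR continuous_on_diff intro: differentiable_affine)
  have "smooth_fun (\<lambda>y. g (s *\<^sub>R (x - y)))"
    unfolding smooth_fun_def higher_partial_affine[OF sm]
    using c d by (auto intro!: continuous_intros)
  moreover have "g (s *\<^sub>R (x - y)) = 0" if "norm x + r / \<bar>s\<bar> < norm y" for y
  proof (rule r(2))
    have "r / \<bar>s\<bar> < norm (x - y)" using that norm_triangle_ineq2[of y x] by (simp add: norm_minus_commute)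
    then show "r < norm (s *\<^sub>R (x - y))" using assms(2) by (simp add: pos_divide_less_eq mult.commute)
  qed
  ultimately show ?thesis by (rule test_funI)
qed

section \<open>Differentiation under the integral sign\<close>

text \<open>Dominated convergence for the remainder quotients: by the mean value inequality on the
  ball each of them is at most \<open>2 * D y\<close>. The parameter lives in a normed space because
  it will be the pair of scale and centre.\<close>

lemma has_derivative_integral_dominated:
  fixes K :: "'p::real_normed_vector \<Rightarrow> 'a \<Rightarrow> real"
  assumes e: "0 < e"
    and der: "\<And>q y. q \<in> ball p e \<Longrightarrow> ((\<lambda>q. K q y) has_derivative K' q y) (at q)"
    and bnd: "\<And>q y h. q \<in> ball p e \<Longrightarrow> \<bar>K' q y h\<bar> \<le> D y * norm h"
    and D: "integrable M D" "\<And>y. 0 \<le> D y"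
    and K: "\<And>q. q \<in> ball p e \<Longrightarrow> integrable M (K q)"
    and K': "\<And>h. (\<lambda>y. K' p y h) \<in> borel_measurable M"
  shows "((\<lambda>q. \<integral>y. K q y \<partial>M) has_derivative (\<lambda>h. \<integral>y. K' p y h \<partial>M)) (at p)"
proof -
  have p: "p \<in> ball p e" using e by simp
  have lin: "bounded_linear (K' p y)" for y
    using der[OF p] by (rule has_derivative_bounded_linear)
  have int: "integrable M (\<lambda>y. K' p y h)" for h
    by (rule Bochner_Integration.integrable_bound[OF integrable_mult_left[OF D(1), of "norm h"] K'])
       (use bnd[OF p] in \<open>auto intro!: AE_I2 intro: order.trans[OF _ abs_ge_self]\<close>)
  have "bounded_linear (\<lambda>h. \<integral>y. K' p y h \<partial>M)"
  proof (rule bounded_linear_intro)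
    show "(\<integral>y. K' p y (h + k) \<partial>M) = (\<integral>y. K' p y h \<partial>M) + (\<integral>y. K' p y k \<partial>M)" for h k
      by (simp add: bounded_linear.linear[OF lin] linear_add int)
    show "(\<integral>y. K' p y (r *\<^sub>R h) \<partial>M) = r *\<^sub>R (\<integral>y. K' p y h \<partial>M)" for r h
      by (simp add: bounded_linear.linear[OF lin] linear_scale)
    have "norm (\<integral>y. K' p y h \<partial>M) \<le> (\<integral>y. D y * norm h \<partial>M)" for h
      using bnd[OF p] D(1) by (intro order.trans[OF integral_norm_bound] integral_mono integrable_norm int) auto
    then show "norm (\<integral>y. K' p y h \<partial>M) \<le> norm h * (\<integral>y. D y \<partial>M)" for h
      using D by (simp add: mult.commute)
  qed
  moreover have "((\<lambda>h. norm ((\<integral>y. K (p + h) y \<partial>M) - (\<integral>y. K p y \<partial>M) - (\<integral>y. K' p y h \<partial>M)) / norm h) \<longlongrightarrow> 0) (at 0 within ball 0 e)"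
    \<comment> \<open>Dominated convergence speaks of sequences, so the limit is tested along
      sequences inside the ball on which the hypotheses hold.\<close>
    unfolding tendsto_at_iff_sequentially
  proof (intro allI impI)
    fix X :: "nat \<Rightarrow> 'p"
    assume X: "\<forall>i. X i \<in> ball 0 e - {0}" and X0: "X \<longlonglongrightarrow> 0"
    define R where "R n y = (K (p + X n) y - K p y - K' p y (X n)) /\<^sub>R norm (X n)" for n y
    have pX: "p + X n \<in> ball p e" for n
      using X by (auto simp: dist_norm)
    have eq: "(\<integral>y. K (p + X n) y \<partial>M) - (\<integral>y. K p y \<partial>M) - (\<integral>y. K' p y (X n) \<partial>M) = norm (X n) * (\<integral>y. R n y \<partial>M)" for n
      using X[rule_format, of n] K[OF pX[of n]] K[OF p] int[of "X n"] by (simp add: R_def)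
    have "(\<lambda>n. \<integral>y. R n y \<partial>M) \<longlonglongrightarrow> (\<integral>y. 0 \<partial>M)"
    proof (rule integral_dominated_convergence)
      show "integrable M (\<lambda>y. 2 * D y)"
        using D by simp
      show "R n \<in> borel_measurable M" for n
        unfolding R_def using K[OF pX[of n]] K[OF p] int[of "X n"] by (intro borel_measurable_integrable) auto
      show "AE y in M. (\<lambda>n. R n y) \<longlonglongrightarrow> 0"
      proof (rule AE_I2)
        fix y
        have "((\<lambda>h. (K (p + h) y - K p y - K' p y h) /\<^sub>R norm h) \<longlongrightarrow> 0) (at 0)"
        proof (rule tendsto_norm_zero_cancel)
          show "((\<lambda>h. norm ((K (p + h) y - K p y - K' p y h) /\<^sub>R norm h)) \<longlongrightarrow> 0) (at 0)"
            using der[OF p, of y] by (simp add: has_derivative_at divide_inverse abs_mult mult.commute)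
        qed
        then show "(\<lambda>n. R n y) \<longlonglongrightarrow> 0"
          unfolding R_def tendsto_at_iff_sequentially using X X0 by (auto simp: o_def)
      qed
      show "AE y in M. norm (R n y) \<le> 2 * D y" for n
      proof (rule AE_I2)
        fix y
        have "norm (K (p + X n) y - K p y) \<le> D y * norm (p + X n - p)"
        proof (rule differentiable_bound[of "ball p e" "\<lambda>q. K q y" "\<lambda>q. K' q y"])
          fix q assume "q \<in> ball p e"
          then show "((\<lambda>q. K q y) has_derivative K' q y) (at q within ball p e)"
            using der has_derivative_at_withinI by blast
          show "onorm (K' q y) \<le> D y"
            using bnd[OF \<open>q \<in> ball p e\<close>] D(2) by (intro onorm_bound) auto
        qed (use p pX in auto)
        then have "\<bar>K (p + X n) y - K p y - K' p y (X n)\<bar> \<le> 2 * D y * norm (X n)"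
          using bnd[OF p, of y "X n"] by simp
        then show "norm (R n y) \<le> 2 * D y"
          using X[rule_format, of n] by (simp add: R_def abs_mult field_simps)
      qed
    qed auto
    then have "(\<lambda>n. norm (\<integral>y. R n y \<partial>M)) \<longlonglongrightarrow> 0"
      by (intro tendsto_norm_zero) simp
    moreover have "norm (norm (X n) * (\<integral>y. R n y \<partial>M)) / norm (X n) = norm (\<integral>y. R n y \<partial>M)" for n
      using X[rule_format, of n] by (simp add: abs_mult)
    ultimately show "((\<lambda>h. norm ((\<integral>y. K (p + h) y \<partial>M) - (\<integral>y. K p y \<partial>M) - (\<integral>y. K' p y h \<partial>M)) / norm h) \<circ> X) \<longlonglongrightarrow> 0"
      by (simp add: o_def eq)
  qed
  ultimately show ?thesis
    unfolding has_derivative_at using e by (simp only: at_within_open[of 0 "ball 0 e"] centre_in_ball open_ball)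
qed

lemma borel_measurable_lebesgue_continuous:
  fixes g :: "'a::euclidean_space \<Rightarrow> 'b::topological_space"
  shows "continuous_on UNIV g \<Longrightarrow> g \<in> borel_measurable lebesgue"
  by (rule measurable_completion) (simp add: borel_measurable_continuous_onI)

lemma integrable_bounded_support:
  fixes g :: "'a::euclidean_space \<Rightarrow> real"
  assumes "g \<in> borel_measurable lebesgue" "\<And>y. \<bar>g y\<bar> \<le> C" "\<And>y. y \<notin> cball c r \<Longrightarrow> g y = 0"
  shows "integrable lebesgue g"
proof (rule Bochner_Integration.integrable_bound)
  show "integrable lebesgue (\<lambda>y. C * indicator (cball c r) y :: real)"
    using emeasure_lborel_cball_finite[of c r] by (intro integrable_mult_right integrable_real_indicator) auto
  show "AE y in lebesgue. norm (g y) \<le> norm (C * indicator (cball c r) y :: real)"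
    using assms(2,3) by (intro AE_I2) (auto simp: indicator_def intro: order.trans[OF _ abs_ge_self])
qed fact

section \<open>Mollification and its joint derivative in scale and centre\<close>

text \<open>The scale is \<open>s = 1/R\<close>, and the normalising power of \<open>s\<close> is left to the applications.\<close>

definition mconv :: "(real^'n::finite \<Rightarrow> real) \<Rightarrow> (real^'n \<Rightarrow> real) \<Rightarrow> real \<Rightarrow> real^'n \<Rightarrow> real" where
  "mconv w k s x = (LINT y|lebesgue. w y * k (s *\<^sub>R (x - y)))"

lemma affine_support:
  fixes x :: "'a::real_normed_vector"
  assumes "\<And>z. r < norm z \<Longrightarrow> k z = 0" "0 < s" "k (s *\<^sub>R (x - y)) \<noteq> 0"
  shows "y \<in> cball x (r / s)"
proof -
  have "norm (s *\<^sub>R (x - y)) \<le> r"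
    using assms(1,3) by (meson not_le)
  then show ?thesis
    using assms(2) by (simp add: dist_norm pos_le_divide_eq mult.commute)
qed

lemma continuous_affine_kernel:
  fixes k :: "'a::real_normed_vector \<Rightarrow> 'b::topological_space"
  shows "continuous_on UNIV k \<Longrightarrow> continuous_on UNIV (\<lambda>y. k (s *\<^sub>R (x - y)))"
  by (rule continuous_on_compose2) (auto intro!: continuous_intros)

lemma measurable_affine_kernel:
  fixes k :: "'a::euclidean_space \<Rightarrow> real"
  shows "continuous_on UNIV k \<Longrightarrow> (\<lambda>y. k (s *\<^sub>R (x - y))) \<in> borel_measurable lebesgue"
  by (intro borel_measurable_lebesgue_continuous continuous_affine_kernel)

lemma mconv_integrable:
  assumes w: "w \<in> borel_measurable lebesgue" "\<And>y. \<bar>w y\<bar> \<le> W" and k: "test_fun k" and s: "0 < s"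
  shows "integrable lebesgue (\<lambda>y. w y * k (s *\<^sub>R (x - y)))"
proof -
  obtain r where r: "0 < r" "\<And>z. r < norm z \<Longrightarrow> k z = 0"
    using test_fun_support[OF k] by blast
  obtain M where M: "0 < M" "\<And>z. \<bar>k z\<bar> \<le> M"
    using test_fun_bounded[OF k] by blast
  show ?thesis
  proof (rule integrable_bounded_support)
    show "(\<lambda>y. w y * k (s *\<^sub>R (x - y))) \<in> borel_measurable lebesgue"
      using w(1) measurable_affine_kernel[OF test_fun_continuous[OF k]] by (rule borel_measurable_times)
    show "\<bar>w y * k (s *\<^sub>R (x - y))\<bar> \<le> W * M" for y
      using mult_mono[OF w(2) M(2)[of "s *\<^sub>R (x - y)"]] order.trans[OF abs_ge_zero w(2)] by (simp add: abs_mult)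
    show "w y * k (s *\<^sub>R (x - y)) = 0" if "y \<notin> cball x (r / s)" for y
      using affine_support[of r k s x y, OF r(2) s] that by auto
  qed
qed

lemma mconv_has_derivative:
  fixes w :: "real^'n::finite \<Rightarrow> real"
  assumes w: "w \<in> borel_measurable lebesgue" "\<And>y. \<bar>w y\<bar> \<le> W" and k: "test_fun k" and s: "0 < s"
  shows "((\<lambda>q. mconv w k (fst q) (snd q)) has_derivative
     (\<lambda>h. LINT y|lebesgue. w y * (\<Sum>i\<in>UNIV. (fst h *\<^sub>R (x - y) + s *\<^sub>R snd h) $ i * partial i k (s *\<^sub>R (x - y))))) (at (s, x))"
  unfolding mconv_def
proof -
  have W: "0 \<le> W"
    using order.trans[OF abs_ge_zero w(2)] .
  obtain r where r: "0 < r" "\<And>z. r < norm z \<Longrightarrow> k z = 0"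
    using test_fun_support[OF k] by blast
  have "\<forall>i. \<exists>M>0. \<forall>z. \<bar>partial i k z\<bar> \<le> M"
    using test_fun_bounded[OF test_fun_partial[OF k]] by metis
  then obtain M where M: "\<And>i. 0 < M i" "\<And>i z. \<bar>partial i k z\<bar> \<le> M i"
    by metis
  \<comment> \<open>Within this radius the scale stays between \<open>s / 2\<close> and
    \<open>2 * s\<close> and the centre moves by less than 1, so all kernels involved are supported
    in \<open>cball x (1 + 2 * r / s)\<close>.\<close>
  define e where "e = min 1 (s / 2)"
  define K where "K q y = w y * k (fst q *\<^sub>R (snd q - y))" for q y
  define K' where "K' q y h = w y * (\<Sum>i\<in>UNIV. (fst h *\<^sub>R (snd q - y) + fst q *\<^sub>R snd h) $ i * partial i k (fst q *\<^sub>R (snd q - y)))"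
    for q and y and h :: "real \<times> (real^'n)"
  \<comment> \<open>On the support the distance from the centre is at most \<open>2 * r / s\<close>.
    The bracket therefore bounds the derivative of the argument of \<open>k\<close> with respect to
    scale and centre.\<close>
  define C where "C = W * ((2 * r / s + 2 * s) * sum M UNIV)"
  define D where "D y = C * indicator (cball x (1 + 2 * r / s)) y" for y
  have C: "0 \<le> C"
    using W s r(1) M(1) by (auto simp: C_def less_imp_le intro!: mult_nonneg_nonneg sum_nonneg add_nonneg_nonneg)
  have ball: "s / 2 < fst q" "fst q < 2 * s" "norm (snd q - x) < 1" if "q \<in> ball (s, x) e" for q
  proof -
    have "\<bar>fst q - s\<bar> < e" "norm (snd q - x) < e"
      using that dist_fst_le[of q "(s, x)"] dist_snd_le[of q "(s, x)"] by (auto simp: dist_norm norm_minus_commute abs_minus_commute)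
    then have "\<bar>fst q - s\<bar> < s / 2" "norm (snd q - x) < 1"
      by (simp_all only: e_def min_less_iff_conj)
    then show "s / 2 < fst q" "fst q < 2 * s" "norm (snd q - x) < 1"
      using s by linarith+
  qed
  have "((\<lambda>q. \<integral>y. K q y \<partial>lebesgue) has_derivative (\<lambda>h. \<integral>y. K' (s, x) y h \<partial>lebesgue)) (at (s, x))"
  proof (rule has_derivative_integral_dominated[of e "(s, x)" K K' D])
    show "0 < e" using s by (simp add: e_def)
    show "integrable lebesgue D"
      unfolding D_def using emeasure_lborel_cball_finite[of x "1 + 2 * r / s"]
      by (intro integrable_mult_right integrable_real_indicator) auto
    show "0 \<le> D y" for y using C by (simp add: D_def)
    show "integrable lebesgue (K q)" if "q \<in> ball (s, x) e" for q
      unfolding K_def using ball[OF that] s by (intro mconv_integrable[OF w k]) auto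
    show "(\<lambda>y. K' (s, x) y h) \<in> borel_measurable lebesgue" for h
    proof -
      have "continuous_on UNIV (\<lambda>y. \<Sum>i\<in>UNIV. (fst h *\<^sub>R (x - y) + s *\<^sub>R snd h) $ i * partial i k (s *\<^sub>R (x - y)))"
        by (rule continuous_on_sum, rule continuous_on_mult[OF _ continuous_affine_kernel])
          (auto intro!: continuous_intros test_fun_continuous[OF test_fun_partial[OF k]])
      then show ?thesis
        unfolding K'_def fst_conv snd_conv
        by (rule borel_measurable_times[OF w(1) borel_measurable_lebesgue_continuous])
    qed
    show "((\<lambda>q. K q y) has_derivative K' q y) (at q)" for q y
    proof -
      have "((\<lambda>q. fst q *\<^sub>R (snd q - y)) has_derivative (\<lambda>h. fst h *\<^sub>R (snd q - y) + fst q *\<^sub>R snd h)) (at q)"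
        by (auto intro!: derivative_eq_intros simp: algebra_simps)
      from has_derivative_compose[OF this has_derivative_partial[OF test_fun_differentiable[OF k]]]
      show ?thesis
        unfolding K_def K'_def by (rule has_derivative_mult_right)
    qed
    show "\<bar>K' q y h\<bar> \<le> D y * norm h" if q: "q \<in> ball (s, x) e" for q y h
    proof (cases "norm (fst q *\<^sub>R (snd q - y)) \<le> r")
      case False
      then have "partial i k (fst q *\<^sub>R (snd q - y)) = 0" for i
        by (intro partial_zero_outside[of r k]) (auto simp: r(2))
      then show ?thesis using C by (simp add: K'_def D_def)
    next
      case True
      have "s / 2 * norm (snd q - y) \<le> fst q * norm (snd q - y)"
        using ball[OF q] by (intro mult_right_mono) auto
      also have "\<dots> \<le> r" using True ball[OF q] s by simp
      finally have y: "norm (snd q - y) \<le> 2 * r / s"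
        using s by (simp add: field_simps)
      have "norm (x - y) \<le> norm (snd q - y) + norm (snd q - x)"
        using norm_triangle_ineq4[of "snd q - y" "snd q - x"] by simp
      then have "y \<in> cball x (1 + 2 * r / s)"
        using y ball(3)[OF q] by (simp add: dist_norm)
      then have Dy: "D y = C" by (simp add: D_def)
      have h: "norm (fst h) \<le> norm h" "norm (snd h) \<le> norm h"
        using norm_fst_le[of "fst h" "snd h"] norm_snd_le[of "snd h" "fst h"] by simp_all
      have "norm (fst h *\<^sub>R (snd q - y) + fst q *\<^sub>R snd h) \<le> norm (fst h) * norm (snd q - y) + \<bar>fst q\<bar> * norm (snd h)"
        by (rule order.trans[OF norm_triangle_ineq]) simp
      also have "\<dots> \<le> norm h * (2 * r / s) + (2 * s) * norm h"
        using h y ball(1,2)[OF q] s by (intro add_mono mult_mono) auto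
      finally have n: "norm (fst h *\<^sub>R (snd q - y) + fst q *\<^sub>R snd h) \<le> (2 * r / s + 2 * s) * norm h"
        by (simp add: algebra_simps)
      have "\<bar>\<Sum>i\<in>UNIV. (fst h *\<^sub>R (snd q - y) + fst q *\<^sub>R snd h) $ i * partial i k (fst q *\<^sub>R (snd q - y))\<bar>
          \<le> (\<Sum>i\<in>UNIV. ((2 * r / s + 2 * s) * norm h) * M i)"
        using order.trans[OF component_le_norm_cart n] M(2) order.trans[OF norm_ge_zero n]
        by (intro order.trans[OF sum_abs] sum_mono) (simp add: abs_mult, intro mult_mono, auto)
      also have "\<dots> = ((2 * r / s + 2 * s) * sum M UNIV) * norm h"
        by (simp add: sum_distrib_left sum_distrib_right mult_ac)
      finally have "\<bar>K' q y h\<bar> \<le> W * (((2 * r / s + 2 * s) * sum M UNIV) * norm h)"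
        unfolding K'_def abs_mult using w(2)[of y] W by (intro mult_mono) auto
      then show ?thesis unfolding Dy C_def by (simp only: mult.assoc)
    qed
  qed
  then show "((\<lambda>q. LINT y|lebesgue. w y * k (fst q *\<^sub>R (snd q - y))) has_derivative
     (\<lambda>h. LINT y|lebesgue. w y * (\<Sum>i\<in>UNIV. (fst h *\<^sub>R (x - y) + s *\<^sub>R snd h) $ i * partial i k (s *\<^sub>R (x - y))))) (at (s, x))"
    by (simp add: K_def K'_def)
qed

section \<open>Estimates for mollifications\<close>

lemma sum_axis: "(\<Sum>i\<in>UNIV. h * axis j 1 $ i * c i) = h * (c j :: real)"
  by (subst sum.mono_neutral_right[of _ "{j}"]) (auto simp: axis_def)

lemma mconv_sum:
  assumes "\<And>i. i \<in> I \<Longrightarrow> integrable lebesgue (\<lambda>y. w y * k i (s *\<^sub>R (x - y)))"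
  shows "mconv w (\<lambda>z. \<Sum>i\<in>I. c i * k i z) s x = (\<Sum>i\<in>I. c i * mconv w (k i) s x)"
proof -
  have "mconv w (\<lambda>z. \<Sum>i\<in>I. c i * k i z) s x = (LINT y|lebesgue. (\<Sum>i\<in>I. c i * (w y * k i (s *\<^sub>R (x - y)))))"
    by (simp add: mconv_def sum_distrib_left mult_ac)
  also have "\<dots> = (\<Sum>i\<in>I. c i * mconv w (k i) s x)"
    using assms by (simp add: mconv_def)
  finally show ?thesis .
qed

lemma mconv_has_derivative_space:
  fixes w :: "real^'n::finite \<Rightarrow> real"
  assumes w: "w \<in> borel_measurable lebesgue" "\<And>y. \<bar>w y\<bar> \<le> W" and k: "test_fun k" and s: "0 < s"
  shows "(mconv w k s has_derivative (\<lambda>h. \<Sum>i\<in>UNIV. h $ i * (s * mconv w (partial i k) s x))) (at x)"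
proof -
  have "((\<lambda>x. (s, x)) has_derivative (\<lambda>h. (0, h))) (at x)"
    by (auto intro!: derivative_eq_intros)
  from has_derivative_compose[OF this mconv_has_derivative[OF w k s]]
  have "(mconv w k s has_derivative (\<lambda>h. LINT y|lebesgue. w y * (\<Sum>i\<in>UNIV. (s * h $ i) * partial i k (s *\<^sub>R (x - y))))) (at x)"
    by simp
  moreover have "(LINT y|lebesgue. w y * (\<Sum>i\<in>UNIV. (s * h $ i) * partial i k (s *\<^sub>R (x - y))))
      = (\<Sum>i\<in>UNIV. h $ i * (s * mconv w (partial i k) s x))" for h
    using mconv_sum[of UNIV w "\<lambda>i. partial i k" s x "\<lambda>i. s * h $ i"] mconv_integrable[OF w test_fun_partial[OF k] s]
    by (simp add: mconv_def mult_ac)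
  ultimately show ?thesis by simp
qed

text \<open>By the chain rule, s d/ds acts on a rescaled kernel as the radial operator z . grad
  before rescaling. This is the origin of the radial term in the kernel identity.\<close>

lemma mconv_has_derivative_scale:
  fixes w :: "real^'n::finite \<Rightarrow> real"
  assumes w: "w \<in> borel_measurable lebesgue" "\<And>y. \<bar>w y\<bar> \<le> W" and k: "test_fun k" and s: "0 < s"
  shows "((\<lambda>s. mconv w k s x) has_real_derivative mconv w (\<lambda>z. \<Sum>i\<in>UNIV. z $ i * partial i k z) s x / s) (at s)"
proof -
  have "((\<lambda>s. (s, x)) has_derivative (\<lambda>h. (h, 0))) (at s)"
    by (auto intro!: derivative_eq_intros)
  from has_derivative_compose[OF this mconv_has_derivative[OF w k s]]
  have "((\<lambda>s. mconv w k s x) has_derivative (\<lambda>h. LINT y|lebesgue. w y * (\<Sum>i\<in>UNIV. (h *\<^sub>R (x - y)) $ i * partial i k (s *\<^sub>R (x - y))))) (at s)"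
    by simp
  also have "(\<lambda>h. LINT y|lebesgue. w y * (\<Sum>i\<in>UNIV. (h *\<^sub>R (x - y)) $ i * partial i k (s *\<^sub>R (x - y))))
      = (*) (mconv w (\<lambda>z. \<Sum>i\<in>UNIV. z $ i * partial i k z) s x / s)"
  proof
    fix h
    have "(LINT y|lebesgue. w y * (\<Sum>i\<in>UNIV. (h *\<^sub>R (x - y)) $ i * partial i k (s *\<^sub>R (x - y))))
        = (LINT y|lebesgue. (h / s) * (w y * (\<Sum>i\<in>UNIV. (s *\<^sub>R (x - y)) $ i * partial i k (s *\<^sub>R (x - y)))))"
      using s by (intro Bochner_Integration.integral_cong) (auto simp: sum_distrib_left intro!: sum.cong)
    then show "(LINT y|lebesgue. w y * (\<Sum>i\<in>UNIV. (h *\<^sub>R (x - y)) $ i * partial i k (s *\<^sub>R (x - y))))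
        = mconv w (\<lambda>z. \<Sum>i\<in>UNIV. z $ i * partial i k z) s x / s * h"
      by (simp add: mconv_def)
  qed
  finally show ?thesis
    unfolding has_field_derivative_def .
qed

text \<open>The supremum of the integrand times the volume of its support, a ball of radius
  \<open>r / s\<close>. The factor \<open>1 / s ^ CARD('n)\<close> is what the normalising power of
  \<open>s\<close> cancels.\<close>

lemma mconv_bound:
  fixes w :: "real^'n::finite \<Rightarrow> real"
  assumes w: "w \<in> borel_measurable lebesgue" "\<And>y. \<bar>w y\<bar> \<le> W" and k: "test_fun k" and s: "0 < s"
    and M: "\<And>z. \<bar>k z\<bar> \<le> M" and r: "0 \<le> r" "\<And>z. r < norm z \<Longrightarrow> k z = 0"
  shows "\<bar>mconv w k s x\<bar> \<le> W * M * (measure lborel (ball (0 :: real^'n) 1) * r ^ CARD('n)) / s ^ CARD('n)"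
proof -
  have "\<bar>mconv w k s x\<bar> \<le> (LINT y|lebesgue. \<bar>w y * k (s *\<^sub>R (x - y))\<bar>)"
    unfolding mconv_def by (rule integral_abs_bound)
  also have "\<dots> \<le> (LINT y|lebesgue. W * M * indicator (cball x (r / s)) y)"
  proof (rule integral_mono)
    show "integrable lebesgue (\<lambda>y. \<bar>w y * k (s *\<^sub>R (x - y))\<bar>)"
      using mconv_integrable[OF w k s] by (rule integrable_abs)
    show "integrable lebesgue (\<lambda>y. W * M * indicator (cball x (r / s)) y)"
      using emeasure_lborel_cball_finite[of x "r / s"]
      by (intro integrable_mult_right integrable_real_indicator) auto
    show "\<bar>w y * k (s *\<^sub>R (x - y))\<bar> \<le> W * M * indicator (cball x (r / s)) y" for y
    proof (cases "k (s *\<^sub>R (x - y)) = 0")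
      case True
      then show ?thesis
        using order.trans[OF abs_ge_zero w(2)] order.trans[OF abs_ge_zero M] by simp
    next
      case False
      then show ?thesis
        using mult_mono[OF w(2)[of y] M[of "s *\<^sub>R (x - y)"]] order.trans[OF abs_ge_zero w(2)]
          affine_support[of r k s x y, OF r(2) s] by (simp add: abs_mult)
    qed
  qed
  also have "\<dots> = W * M * measure lborel (cball x (r / s))"
    by simp
  also have "\<dots> = W * M * (measure lborel (ball (0 :: real^'n) 1) * r ^ CARD('n)) / s ^ CARD('n)"
    using content_ball_conv_unit_ball[of "r / s" x] r(1) s
    by (simp add: content_cball_conv_ball power_divide mult.commute)
  finally show ?thesis .
qed

section \<open>Translations and the gain from Hoelder continuity in one direction\<close>

lemma lebesgue_translation:
  fixes v :: "'a::euclidean_space"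
  shows lebesgue_measurable_translation: "(\<lambda>y. v + y) \<in> lebesgue \<rightarrow>\<^sub>M lebesgue"
    and lebesgue_distr_translation: "distr lebesgue lebesgue (\<lambda>y. v + y) = lebesgue"
  using lebesgue_affine_measurable[of "\<lambda>_. 1" v] lebesgue_affine_euclidean[of "\<lambda>_. 1" v]
  by (simp_all add: euclidean_representation density_1)

lemma measurable_translate:
  assumes "w \<in> borel_measurable lebesgue"
  shows "(\<lambda>y. w (v + y)) \<in> borel_measurable lebesgue"
  using measurable_comp[OF lebesgue_measurable_translation assms] by (simp add: o_def)

lemma integral_translate:
  fixes g :: "'a::euclidean_space \<Rightarrow> real"
  assumes "g \<in> borel_measurable lebesgue"
  shows "(LINT y|lebesgue. g (v + y)) = (LINT y|lebesgue. g y)"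
  using integral_distr[OF lebesgue_measurable_translation assms, of v]
  by (simp add: lebesgue_distr_translation)

lemma mconv_translate:
  assumes "w \<in> borel_measurable lebesgue" "test_fun k"
  shows "mconv w k s (x + v) = mconv (\<lambda>y. w (v + y)) k s x"
proof -
  have "(\<lambda>y. w y * k (s *\<^sub>R (x + v - y))) \<in> borel_measurable lebesgue"
    using assms(1) measurable_affine_kernel[OF test_fun_continuous[OF assms(2)]] by (rule borel_measurable_times)
  from integral_translate[OF this, of v] show ?thesis
    by (simp add: mconv_def)
qed

text \<open>The mean value theorem along \<open>e\<^sub>j\<close> replaces subtracting \<open>f(x', y'')\<close> under the integral, a function
  that need not be measurable.\<close>

lemma mconv_partial_bound:
  fixes f :: "real^'n::finite \<Rightarrow> real"
  assumes f: "f \<in> borel_measurable lebesgue" "\<And>y. \<bar>f y\<bar> \<le> F" and k: "test_fun k" and s: "0 < s"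
    and hoelder: "\<And>y t. 0 < t \<Longrightarrow> \<bar>f (t *\<^sub>R axis j 1 + y) - f y\<bar> \<le> H * t powr \<delta>" and \<delta>: "0 < \<delta>"
    and M: "\<And>z. \<bar>k z\<bar> \<le> M" "\<And>z. \<bar>partial j k z\<bar> \<le> M" and r: "0 \<le> r" "\<And>z. r < norm z \<Longrightarrow> k z = 0"
  shows "\<bar>mconv f (partial j k) s x\<bar> \<le> 2 * H * M * (measure lborel (ball (0 :: real^'n) 1) * r ^ CARD('n)) / s ^ CARD('n) * s powr (-\<delta>)"
proof -
  define e :: "real^'n" where "e = axis j 1"
  define c where "c = M * (measure lborel (ball (0 :: real^'n) 1) * r ^ CARD('n)) / s ^ CARD('n)"
  have M0: "0 \<le> M" using order.trans[OF abs_ge_zero M(1)] .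
  have H0: "0 \<le> H" using order.trans[OF abs_ge_zero hoelder[of 1 0]] by simp
  have c0: "0 \<le> c" unfolding c_def using M0 r s by auto
  note k' = test_fun_partial[OF k, of j]
  \<comment> \<open>Moving the centre along \<open>e\<close> amounts to translating \<open>f\<close>
    along \<open>e\<close>, and only such increments of \<open>f\<close> are controlled.\<close>
  have diff: "\<bar>mconv f h s (x + t *\<^sub>R e) - mconv f h s x\<bar> \<le> H * t powr \<delta> * c"
    if h: "test_fun h" "\<And>z. \<bar>h z\<bar> \<le> M" "\<And>z. r < norm z \<Longrightarrow> h z = 0" and t: "0 < t" for h t
  proof -
    have ft: "(\<lambda>y. f (t *\<^sub>R e + y)) \<in> borel_measurable lebesgue"
      by (rule measurable_translate[OF f(1)])
    have "mconv f h s (x + t *\<^sub>R e) - mconv f h s x = mconv (\<lambda>y. f (t *\<^sub>R e + y)) h s x - mconv f h s x"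
      by (simp add: mconv_translate[OF f(1) h(1)])
    also have "\<dots> = mconv (\<lambda>y. f (t *\<^sub>R e + y) - f y) h s x"
      using mconv_integrable[OF f h(1) s, of x] mconv_integrable[OF ft f(2) h(1) s, of x]
      by (simp add: mconv_def left_diff_distrib)
    also have "\<bar>\<dots>\<bar> \<le> H * t powr \<delta> * M * (measure lborel (ball (0 :: real^'n) 1) * r ^ CARD('n)) / s ^ CARD('n)"
      using ft f(1) h r(1) hoelder[OF t] s by (intro mconv_bound borel_measurable_diff) (auto simp: e_def)
    finally show ?thesis by (simp add: c_def mult_ac)
  qed
  have "((\<lambda>t. mconv f k s (x + t *\<^sub>R e)) has_real_derivative s * mconv f (partial j k) s (x + t *\<^sub>R e)) (at t)" for t
  proof -
    have "((\<lambda>t. x + t *\<^sub>R e) has_derivative (\<lambda>h. h *\<^sub>R e)) (at t)"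
      by (auto intro!: derivative_eq_intros)
    from has_derivative_compose[OF this mconv_has_derivative_space[OF f k s]]
    show ?thesis
      by (simp add: has_field_derivative_def e_def sum_axis mult_commute_abs)
  qed
  \<comment> \<open>The step \<open>1 / s\<close> cancels the factor \<open>s\<close> from
    differentiation: the mollification with \<open>partial j k\<close> at some nearby point is
    itself an increment of a mollification. Returning from that point to \<open>x\<close> costs
    another increment over a distance below \<open>1 / s\<close>.\<close>
  then have "\<exists>z. 0 < z \<and> z < 1 / s \<and> mconv f k s (x + (1 / s) *\<^sub>R e) - mconv f k s (x + 0 *\<^sub>R e)
      = (1 / s - 0) * (s * mconv f (partial j k) s (x + z *\<^sub>R e))"
    using s by (intro MVT2) auto
  then obtain z where z: "0 < z" "z < 1 / s"
    and eq: "mconv f k s (x + (1 / s) *\<^sub>R e) - mconv f k s x = mconv f (partial j k) s (x + z *\<^sub>R e)"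
    using s by auto
  have "\<bar>mconv f (partial j k) s x\<bar> \<le> \<bar>mconv f (partial j k) s (x + z *\<^sub>R e) - mconv f (partial j k) s x\<bar>
      + \<bar>mconv f k s (x + (1 / s) *\<^sub>R e) - mconv f k s x\<bar>"
    unfolding eq by simp
  also have "\<dots> \<le> H * z powr \<delta> * c + H * (1 / s) powr \<delta> * c"
    using M r k k' s z partial_zero_outside[of r k] by (intro add_mono diff) auto
  also have "\<dots> \<le> H * (1 / s) powr \<delta> * c + H * (1 / s) powr \<delta> * c"
    using z \<delta> H0 c0 by (intro add_mono mult_right_mono mult_left_mono powr_mono2) auto
  also have "\<dots> = 2 * H * M * (measure lborel (ball (0 :: real^'n) 1) * r ^ CARD('n)) / s ^ CARD('n) * s powr (-\<delta>)"
    using s by (simp add: c_def powr_divide powr_minus_divide mult_ac)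
  finally show ?thesis .
qed

text \<open>Adding \<open>A / \<gamma> * r powr \<gamma>\<close> to \<open>F\<close> or to its
  negative gives a nondecreasing function. This avoids integrating \<open>F'\<close>, and it treats
  both signs of \<gamma> at once.\<close>

lemma powr_increment_bound:
  fixes F :: "real \<Rightarrow> real"
  assumes F: "\<And>r. 0 < r \<Longrightarrow> (F has_real_derivative F' r) (at r)" "\<And>r. 0 < r \<Longrightarrow> \<bar>F' r\<bar> \<le> A * r powr (\<gamma> - 1)"
    and "\<gamma> \<noteq> 0" "0 < s" "s \<le> t"
  shows "\<bar>F t - F s\<bar> \<le> A * (t powr \<gamma> - s powr \<gamma>) / \<gamma>"
proof -
  have *: "c * F s + A / \<gamma> * s powr \<gamma> \<le> c * F t + A / \<gamma> * t powr \<gamma>" if "\<bar>c\<bar> = 1" for c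
  proof (rule DERIV_nonneg_imp_nondecreasing[OF \<open>s \<le> t\<close>])
    fix r assume r: "s \<le> r" "r \<le> t"
    have "((\<lambda>r. c * F r + A / \<gamma> * r powr \<gamma>) has_real_derivative c * F' r + A * r powr (\<gamma> - 1)) (at r)"
      using r assms by (auto intro!: derivative_eq_intros F(1))
    moreover have "\<bar>c * F' r\<bar> \<le> A * r powr (\<gamma> - 1)"
      using F(2)[of r] r assms that by (simp add: abs_mult)
    ultimately show "\<exists>y. ((\<lambda>r. c * F r + A / \<gamma> * r powr \<gamma>) has_real_derivative y) (at r) \<and> 0 \<le> y"
      by (intro exI[of _ "c * F' r + A * r powr (\<gamma> - 1)"]) (auto simp: abs_le_iff)
  qed
  from *[of 1] *[of "-1"] show ?thesis
    by (simp add: abs_le_iff diff_divide_distrib right_diff_distrib)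
qed

section \<open>Local integrability and weak derivatives tested with kernels\<close>

lemma L2_loc_imp_set_integrable:
  assumes "L2_loc g" "compact K"
  shows "set_integrable lebesgue K g"
  unfolding set_integrable_def
proof (rule Bochner_Integration.integrable_bound)
  have K: "integrable lebesgue (indicator K :: _ \<Rightarrow> real)"
    using assms(2) emeasure_compact_finite[of K] by (intro integrable_real_indicator) (auto dest: compact_imp_closed)
  show "integrable lebesgue (\<lambda>x. indicator K x + indicator K x *\<^sub>R (g x)\<^sup>2)"
    using assms K by (intro Bochner_Integration.integrable_add) (auto simp: L2_loc_def set_integrable_def)
  show "(\<lambda>x. indicator K x *\<^sub>R g x) \<in> borel_measurable lebesgue"
    using assms K by (intro borel_measurable_scaleR borel_measurable_integrable[OF K]) (auto simp: L2_loc_def)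
  have "\<bar>t\<bar> \<le> 1 + t\<^sup>2" for t :: real
    using zero_le_power2[of "\<bar>t\<bar> - 1"] zero_le_power2[of t] by (simp add: power2_diff)
  then show "AE x in lebesgue. norm (indicator K x *\<^sub>R g x) \<le> norm (indicator K x + indicator K x *\<^sub>R (g x)\<^sup>2)"
    by (intro AE_I2) (auto simp: indicator_def)
qed

lemma loc_integrable_times_bounded:
  fixes g :: "real^'n::finite \<Rightarrow> real"
  assumes g: "L2_loc g" and \<phi>: "\<phi> \<in> borel_measurable lebesgue" "\<And>y. \<bar>\<phi> y\<bar> \<le> C" "\<And>y. y \<notin> cball c r \<Longrightarrow> \<phi> y = 0"
  shows "integrable lebesgue (\<lambda>y. g y * \<phi> y)"
proof (rule Bochner_Integration.integrable_bound)
  have g': "set_integrable lebesgue (cball c r) g"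
    by (intro L2_loc_imp_set_integrable g) auto
  then show "integrable lebesgue (\<lambda>y. C * (indicator (cball c r) y *\<^sub>R g y))"
    unfolding set_integrable_def by (rule integrable_mult_right)
  show "(\<lambda>y. g y * \<phi> y) \<in> borel_measurable lebesgue"
    using g \<phi>(1) by (auto simp: L2_loc_def)
  show "AE y in lebesgue. norm (g y * \<phi> y) \<le> norm (C * (indicator (cball c r) y *\<^sub>R g y))"
  proof (rule AE_I2)
    fix y
    have "\<bar>g y\<bar> * \<bar>\<phi> y\<bar> \<le> \<bar>g y\<bar> * \<bar>C\<bar>"
      using \<phi>(2)[of y] by (intro mult_left_mono) auto
    then show "norm (g y * \<phi> y) \<le> norm (C * (indicator (cball c r) y *\<^sub>R g y))"
      using \<phi>(3)[of y] by (auto simp: indicator_def abs_mult mult.commute)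
  qed
qed

lemma L2_loc_times_test_fun:
  assumes g: "L2_loc g" and \<phi>: "test_fun \<phi>"
  shows "integrable lebesgue (\<lambda>y. g y * \<phi> y)"
proof -
  obtain r where r: "0 < r" "\<And>z. r < norm z \<Longrightarrow> \<phi> z = 0"
    using test_fun_support[OF \<phi>] by blast
  obtain M where M: "0 < M" "\<And>z. \<bar>\<phi> z\<bar> \<le> M"
    using test_fun_bounded[OF \<phi>] by blast
  show ?thesis
    using r(2) by (intro loc_integrable_times_bounded[OF g, of _ M 0 r] M borel_measurable_lebesgue_continuous
        test_fun_continuous[OF \<phi>]) auto
qed

lemma partial_affine_kernel:
  assumes "smooth_fun k"
  shows "partial i (\<lambda>y. k (s *\<^sub>R (x - y))) = (\<lambda>y. - s * partial i k (s *\<^sub>R (x - y)))"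
  using partial_affine[OF smooth_fun_differentiable[OF assms]] by blast

text \<open>The test function is the kernel seen as a function of \<open>y\<close>; the minus sign
  from differentiating \<open>x - y\<close> cancels the one in the definition of the weak
  derivative.\<close>

lemma mconv_weak_deriv1:
  assumes "weak_deriv1 i u v" and k: "test_fun k" and s: "0 < s"
  shows "s * mconv u (partial i k) s x = mconv v k s x"
proof -
  have "(LINT y|lebesgue. u y * (- s * partial i k (s *\<^sub>R (x - y)))) = - mconv v k s x"
    using assms(1)[unfolded weak_deriv1_def, rule_format, OF test_fun_affine[OF k, of s x]] s
    by (simp add: mconv_def partial_affine_kernel[OF test_fun_smooth[OF k]])
  moreover have "(LINT y|lebesgue. u y * (- s * partial i k (s *\<^sub>R (x - y)))) = (LINT y|lebesgue. (- s) * (u y * partial i k (s *\<^sub>R (x - y))))"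
    by (simp add: mult_ac)
  ultimately show ?thesis by (simp add: mconv_def)
qed

lemma mconv_weak_deriv2:
  assumes "weak_deriv2 i j u v" and k: "test_fun k" and s: "0 < s"
  shows "s\<^sup>2 * mconv u (partial i (partial j k)) s x = mconv v k s x"
proof -
  have "partial i (partial j (\<lambda>y. k (s *\<^sub>R (x - y)))) = (\<lambda>y. s\<^sup>2 * partial i (partial j k) (s *\<^sub>R (x - y)))"
    using higher_partial_affine[OF test_fun_smooth[OF k], of "[i, j]" s x] by (simp add: power2_eq_square)
  then have "(LINT y|lebesgue. u y * (s\<^sup>2 * partial i (partial j k) (s *\<^sub>R (x - y)))) = mconv v k s x"
    using assms(1)[unfolded weak_deriv2_def, rule_format, OF test_fun_affine[OF k, of s x]] s
    by (simp add: mconv_def)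
  moreover have "(LINT y|lebesgue. u y * (s\<^sup>2 * partial i (partial j k) (s *\<^sub>R (x - y)))) = (LINT y|lebesgue. s\<^sup>2 * (u y * partial i (partial j k) (s *\<^sub>R (x - y))))"
    by (simp add: mult_ac)
  ultimately show ?thesis by (simp add: mconv_def)
qed

section \<open>Identification of the limit of mollifications\<close>

text \<open>The positive and negative parts of \<open>h\<close> are densities of two measures that
  agree on boxes. Boxes are an intersection-stable generator, so the measures agree, and then so do
  their densities almost everywhere.\<close>

lemma AE_eq_0_if_box_integrals_0:
  fixes h :: "'a::euclidean_space \<Rightarrow> real"
  assumes meas: "h \<in> borel_measurable lebesgue"
    and int: "\<And>l u. integrable lebesgue (\<lambda>x. indicator (box l u) x * h x)"
    and zero: "\<And>l u. (LINT x|lebesgue. indicator (box l u) x * h x) = 0"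
  shows "AE x in lebesgue. h x = 0"
proof -
  \<comment> \<open>Boxes generate only the Borel sets, hence the passage to a Borel
    representative.\<close>
  obtain h' where h'[measurable]: "h' \<in> borel_measurable lborel" and eq: "AE x in lborel. h x = h' x"
    using completion_ex_borel_measurable_real[OF meas] by blast
  have eq': "AE x in lebesgue. h x = h' x"
    using eq by (rule AE_completion)
  have meas': "h' \<in> borel_measurable lebesgue"
    using h' by (rule measurable_completion)
  have box_meas: "(\<lambda>x. indicator (box l u) x * h' x) \<in> borel_measurable lborel" for l u
    by measurable
  have int': "integrable lborel (\<lambda>x. indicator (box l u) x * h' x)" for l u
  proof -
    have "integrable lebesgue (\<lambda>x. indicator (box l u) x * h' x)"
      by (rule integrable_cong_AE_imp[OF int]) (use eq' box_meas in \<open>auto intro: measurable_completion\<close>)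
    then show ?thesis using integrable_completion[OF box_meas] by simp
  qed
  have zero': "(LINT x|lborel. indicator (box l u) x * h' x) = 0" for l u
  proof -
    have "(LINT x|lebesgue. indicator (box l u) x * h x) = (LINT x|lebesgue. indicator (box l u) x * h' x)"
      using eq' int[THEN borel_measurable_integrable] box_meas[THEN measurable_completion]
      by (intro integral_cong_AE) auto
    then show ?thesis using zero integral_completion[OF box_meas] by simp
  qed
  have nn: "(\<integral>\<^sup>+x. ennreal (h' x) * indicator (box l u) x \<partial>lborel) = (\<integral>\<^sup>+x. ennreal (- h' x) * indicator (box l u) x \<partial>lborel)"
    and fin: "(\<integral>\<^sup>+x. ennreal (h' x) * indicator (box l u) x \<partial>lborel) \<noteq> \<infinity>" for l u
  proof -
    let ?g = "\<lambda>x. indicator (box l u) x * h' x"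
    have e1: "(\<integral>\<^sup>+x. ennreal (h' x) * indicator (box l u) x \<partial>lborel) = (\<integral>\<^sup>+x. ennreal (?g x) \<partial>lborel)"
      by (intro nn_integral_cong) (simp split: split_indicator)
    have e2: "(\<integral>\<^sup>+x. ennreal (- h' x) * indicator (box l u) x \<partial>lborel) = (\<integral>\<^sup>+x. ennreal (- ?g x) \<partial>lborel)"
      by (intro nn_integral_cong) (simp split: split_indicator)
    have f1: "(\<integral>\<^sup>+x. ennreal (?g x) \<partial>lborel) \<noteq> \<infinity>" and f2: "(\<integral>\<^sup>+x. ennreal (- ?g x) \<partial>lborel) \<noteq> \<infinity>"
      using int'[of l u] by (simp_all add: real_integrable_def)
    have "enn2real (\<integral>\<^sup>+x. ennreal (?g x) \<partial>lborel) = enn2real (\<integral>\<^sup>+x. ennreal (- ?g x) \<partial>lborel)"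
      using real_lebesgue_integral_def[OF int'[of l u]] zero'[of l u] by simp
    then show "(\<integral>\<^sup>+x. ennreal (h' x) * indicator (box l u) x \<partial>lborel) = (\<integral>\<^sup>+x. ennreal (- h' x) * indicator (box l u) x \<partial>lborel)"
      unfolding e1 e2 using f1 f2
      by (cases "\<integral>\<^sup>+x. ennreal (?g x) \<partial>lborel"; cases "\<integral>\<^sup>+x. ennreal (- ?g x) \<partial>lborel") auto
    show "(\<integral>\<^sup>+x. ennreal (h' x) * indicator (box l u) x \<partial>lborel) \<noteq> \<infinity>"
      unfolding e1 by (rule f1)
  qed
  \<comment> \<open>\<open>ennreal\<close> sends negative reals to 0, so these densities are the
    positive and the negative part.\<close>
  have "density lborel (\<lambda>x. ennreal (h' x)) = density lborel (\<lambda>x. ennreal (- h' x))" (is "?M = ?N")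
  proof (rule measure_eqI_generator_eq)
    let ?E = "range (\<lambda>(a, b). box a b::'a set)"
    show "Int_stable ?E"
      by (auto simp: Int_stable_def box_Int_box)
    show "?E \<subseteq> Pow UNIV" "sets ?M = sigma_sets UNIV ?E" "sets ?N = sigma_sets UNIV ?E"
      by (simp_all add: borel_eq_box)
    let ?A = "\<lambda>n::nat. box (- (real n *\<^sub>R One)) (real n *\<^sub>R One) :: 'a set"
    show "range ?A \<subseteq> ?E" "(\<Union>i. ?A i) = UNIV"
      unfolding UN_box_eq_UNIV by auto
    show "emeasure ?M (?A i) \<noteq> \<infinity>" for i
      using fin by (simp add: emeasure_density)
    show "emeasure ?M X = emeasure ?N X" if "X \<in> ?E" for X
      using that nn by (auto simp: emeasure_density)
  qed
  then have "AE x in lborel. ennreal (h' x) = ennreal (- h' x)"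
    by (intro sigma_finite_measure.density_unique[OF sigma_finite_lborel]) auto
  then have "AE x in lborel. h' x = 0"
  proof (rule AE_mp, intro AE_I2 impI)
    fix x assume "ennreal (h' x) = ennreal (- h' x)"
    then show "h' x = 0"
      by (cases "0 \<le> h' x") (auto simp: ennreal_neg ennreal_eq_0_iff eq_commute[of 0])
  qed
  then have "AE x in lebesgue. h' x = 0"
    by (rule AE_completion)
  with eq' show ?thesis by eventually_elim simp
qed

lemma flat_0_le_1: "flat 0 t \<le> 1"
  by (simp add: flat_def)

lemma AE_eq_0_if_test_integrals_0:
  fixes h :: "real^'n::finite \<Rightarrow> real"
  assumes meas: "h \<in> borel_measurable lebesgue"
    and int: "\<And>K. compact K \<Longrightarrow> set_integrable lebesgue K h"
    and zero: "\<And>\<phi>. test_fun \<phi> \<Longrightarrow> (LINT x|lebesgue. h x * \<phi> x) = 0"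
  shows "AE x in lebesgue. h x = 0"
proof (rule AE_eq_0_if_box_integrals_0[OF meas])
  fix l u :: "real^'n"
  have K: "integrable lebesgue (\<lambda>x. indicator (cbox l u) x * h x)"
    using int[of "cbox l u"] by (simp add: set_integrable_def)
  have bm: "(\<lambda>x. indicator (box l u) x * h x) \<in> borel_measurable lebesgue"
    using meas by (intro borel_measurable_times borel_measurable_indicator) auto
  show "integrable lebesgue (\<lambda>x. indicator (box l u) x * h x)"
    using K bm by (rule Bochner_Integration.integrable_bound)
      (use box_subset_cbox in \<open>auto intro!: AE_I2 simp: indicator_def\<close>)
  \<comment> \<open>Smooth approximations of the indicator of the open box: zero outside it, and
    tending to 1 inside because exp (-1/(n c)) tends to 1 for every c > 0.\<close>
  define \<phi> where "\<phi> n x = (\<Prod>i\<in>UNIV. flat 0 (n * (x $ i - l $ i)) * flat 0 (n * (u $ i - x $ i)))"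
    for n :: real and x :: "real^'n"
  have nonneg: "0 \<le> \<phi> n x" and le1: "\<phi> n x \<le> 1" for n x
    unfolding \<phi>_def by (auto intro!: prod_nonneg prod_le_1 mult_le_one flat_0_le_1)
  have outside: "\<phi> n x = 0" if "x \<notin> box l u" "0 < n" for n x
  proof -
    have "\<exists>i. x $ i \<le> l $ i \<or> u $ i \<le> x $ i"
      using that(1) unfolding mem_box_cart not_less[symmetric] by blast
    then obtain i where "x $ i \<le> l $ i \<or> u $ i \<le> x $ i"
      by (rule exE)
    then have "n * (x $ i - l $ i) \<le> 0 \<or> n * (u $ i - x $ i) \<le> 0"
      using that(2) by (simp add: mult_le_0_iff)
    then have "flat 0 (n * (x $ i - l $ i)) * flat 0 (n * (u $ i - x $ i)) = 0"
      by auto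
    then show ?thesis unfolding \<phi>_def by (intro prod_zero) auto
  qed
  have "smooth_family \<phi>"
    unfolding \<phi>_def
    by (intro smooth_family_prod smooth_family.mult smooth_family.flat smooth_family.const smooth_family_diff smooth_family.coord continuous_intros)
  then have test: "test_fun (\<phi> n)" if "0 < n" for n
  proof -
    have "bounded (box l u)" by (rule bounded_box)
    then obtain r where "\<And>x. x \<in> box l u \<Longrightarrow> norm x \<le> r" by (auto simp: bounded_iff)
    then show ?thesis
      using outside[OF _ that] by (intro test_funI[of _ r] smooth_family_smooth[OF \<open>smooth_family \<phi>\<close>]) force
  qed
  have "(\<lambda>n. LINT x|lebesgue. h x * \<phi> (real (Suc n)) x) \<longlonglongrightarrow> (LINT x|lebesgue. indicator (box l u) x * h x)"
  proof (rule integral_dominated_convergence)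
    show "integrable lebesgue (\<lambda>x. \<bar>indicator (cbox l u) x * h x\<bar>)"
      using K by (rule integrable_abs)
    show "(\<lambda>x. h x * \<phi> (real (Suc n)) x) \<in> borel_measurable lebesgue" for n
      using test[of "real (Suc n)"] by (intro borel_measurable_times meas borel_measurable_lebesgue_continuous test_fun_continuous) auto
    show "AE x in lebesgue. norm (h x * \<phi> (real (Suc n)) x) \<le> \<bar>indicator (cbox l u) x * h x\<bar>" for n
    proof (rule AE_I2)
      fix x
      show "norm (h x * \<phi> (real (Suc n)) x) \<le> \<bar>indicator (cbox l u) x * h x\<bar>"
        using mult_left_mono[OF le1[of "real (Suc n)" x], of "\<bar>h x\<bar>"] nonneg[of "real (Suc n)" x] outside[of x "real (Suc n)"] box_subset_cbox[of l u]
        by (cases "x \<in> box l u") (auto simp: abs_mult indicator_def)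
    qed
    show "AE x in lebesgue. (\<lambda>n. h x * \<phi> (real (Suc n)) x) \<longlonglongrightarrow> indicator (box l u) x * h x"
    proof (rule AE_I2)
      fix x
      show "(\<lambda>n. h x * \<phi> (real (Suc n)) x) \<longlonglongrightarrow> indicator (box l u) x * h x"
      proof (cases "x \<in> box l u")
        case False
        then show ?thesis by (simp add: outside)
      next
        case True
        have "(\<lambda>n. flat 0 (real (Suc n) * c)) \<longlonglongrightarrow> 1" if "0 < c" for c
        proof -
          have "(\<lambda>n. exp (- ((1 / c) * inverse (real (Suc n))))) \<longlonglongrightarrow> exp (- ((1 / c) * 0))"
            by (intro tendsto_intros LIMSEQ_inverse_real_of_nat)
          moreover have "flat 0 (real (Suc n) * c) = exp (- ((1 / c) * inverse (real (Suc n))))" for n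
            using that by (simp add: flat_def divide_inverse)
          ultimately show ?thesis by simp
        qed
        then have "(\<lambda>n. \<phi> (real (Suc n)) x) \<longlonglongrightarrow> (\<Prod>i\<in>(UNIV :: 'n set). 1 * 1)"
          unfolding \<phi>_def using True by (intro tendsto_prod) (intro tendsto_mult, auto simp: mem_box_cart)
        then have "(\<lambda>n. h x * \<phi> (real (Suc n)) x) \<longlonglongrightarrow> h x * 1"
          by (intro tendsto_mult) auto
        then show ?thesis using True by simp
      qed
    qed
  qed (use bm in auto)
  then show "(LINT x|lebesgue. indicator (box l u) x * h x) = 0"
    using zero[OF test] by (simp add: LIMSEQ_const_iff)
qed

section \<open>Weak convergence of mollifications\<close>

lemma lborel_integral_affine:
  fixes g :: "'a::euclidean_space \<Rightarrow> real"
  assumes "g \<in> borel_measurable lborel" "c \<noteq> 0"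
  shows "(LINT x|lborel. g x) = \<bar>c\<bar> ^ DIM('a) * (LINT z|lborel. g (t + c *\<^sub>R z))"
proof -
  have "(LINT x|lborel. g x) = (LINT x|density (distr lborel borel (\<lambda>x. t + c *\<^sub>R x)) (\<lambda>_. ennreal (\<bar>c\<bar> ^ DIM('a))). g x)"
    using lborel_affine[OF assms(2), of t] by (simp add: ennreal_power)
  also have "\<dots> = \<bar>c\<bar> ^ DIM('a) * (LINT z|lborel. g (t + c *\<^sub>R z))"
    using assms(1) by (subst integral_density) (auto simp: integral_distr)
  finally show ?thesis .
qed

lemma mconv_cong_AE:
  assumes "AE y in lebesgue. w y = w' y" "w \<in> borel_measurable lebesgue" "w' \<in> borel_measurable lebesgue" "test_fun k"
  shows "mconv w k s x = mconv w' k s x"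
proof -
  note m = measurable_affine_kernel[OF test_fun_continuous[OF assms(4)], of s x]
  have "AE y in lebesgue. w y * k (s *\<^sub>R (x - y)) = w' y * k (s *\<^sub>R (x - y))"
    using assms(1) by eventually_elim simp
  then show ?thesis unfolding mconv_def
    by (rule integral_cong_AE[OF borel_measurable_times[OF assms(2) m] borel_measurable_times[OF assms(3) m]])
qed

lemma test_fun_integrable:
  assumes "test_fun k"
  shows "integrable lebesgue k"
proof -
  obtain r where r: "0 < r" "\<And>z. r < norm z \<Longrightarrow> k z = 0"
    using test_fun_support[OF assms] by blast
  obtain M where M: "0 < M" "\<And>z. \<bar>k z\<bar> \<le> M"
    using test_fun_bounded[OF assms] by blast
  show ?thesis
    using M r by (intro integrable_bounded_support[of k M 0 r] borel_measurable_lebesgue_continuous test_fun_continuous[OF assms]) auto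
qed

text \<open>Fubini and the substitution x = y + z/s move the mollification from \<open>g\<close> to
  the test function. \<open>g\<close> is taken Borel measurable so that the integrand is measurable
  for the product of \<open>lborel\<close> with itself.\<close>

lemma mconv_test_integral:
  fixes g :: "real^'n::finite \<Rightarrow> real"
  assumes g: "g \<in> borel_measurable lborel" "L2_loc g" and k: "test_fun k" and \<phi>: "test_fun \<phi>" and s: "0 < s"
  shows "integrable lebesgue (\<lambda>x. mconv g k s x * \<phi> x)"
    and "s ^ CARD('n) * (LINT x|lebesgue. mconv g k s x * \<phi> x)
      = (LINT y|lebesgue. g y * (LINT z|lebesgue. k z * \<phi> (y + z /\<^sub>R s)))"
    and "(\<lambda>y. LINT z|lebesgue. k z * \<phi> (y + z /\<^sub>R s)) \<in> borel_measurable lborel"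
proof -
  have [measurable]: "k \<in> borel_measurable borel" "\<phi> \<in> borel_measurable borel" "g \<in> borel_measurable borel"
    using test_fun_continuous[OF k] test_fun_continuous[OF \<phi>] g(1) by (auto intro: borel_measurable_continuous_onI)
  obtain r1 where r1: "0 < r1" "\<And>z. r1 < norm z \<Longrightarrow> k z = 0"
    using test_fun_support[OF k] by blast
  obtain r2 where r2: "0 < r2" "\<And>z. r2 < norm z \<Longrightarrow> \<phi> z = 0"
    using test_fun_support[OF \<phi>] by blast
  obtain M where M: "0 < M" "\<And>z. \<bar>k z\<bar> \<le> M"
    using test_fun_bounded[OF k] by blast
  \<comment> \<open>The supports of \<phi> and of the rescaled kernel confine \<open>y\<close> to
    this ball, on which \<open>g\<close> is integrable.\<close>
  define B where "B = cball (0 :: real^'n) (r2 + r1 / s)"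
  have Bb [measurable]: "B \<in> sets borel" by (simp add: B_def)
  have gB: "integrable lborel (\<lambda>y. \<bar>g y\<bar> * indicator B y)"
  proof -
    have "integrable lebesgue (\<lambda>y. \<bar>indicator B y *\<^sub>R g y\<bar>)"
      using L2_loc_imp_set_integrable[OF g(2), of B] by (intro integrable_abs) (simp add: B_def set_integrable_def)
    then have "integrable lborel (\<lambda>y. \<bar>indicator B y *\<^sub>R g y\<bar>)"
      by (subst (asm) integrable_completion) auto
    then show ?thesis by (simp add: abs_mult mult.commute)
  qed
  have \<phi>i: "integrable lborel (\<lambda>x. \<bar>\<phi> x\<bar>)"
  proof -
    have "integrable lebesgue \<phi>"
      by (rule test_fun_integrable[OF \<phi>])
    then show ?thesis by (subst (asm) integrable_completion) auto
  qed
  let ?G = "\<lambda>x y. g y * k (s *\<^sub>R (x - y)) * \<phi> x"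
  have dom: "\<bar>?G x y\<bar> \<le> \<bar>M * (\<bar>\<phi> x\<bar> * (\<bar>g y\<bar> * indicator B y))\<bar>" for x y
  proof (cases "k (s *\<^sub>R (x - y)) = 0 \<or> \<phi> x = 0")
    case False
    then have "norm x \<le> r2" "y \<in> cball x (r1 / s)"
      using r2(2) affine_support[of r1 k s x y, OF r1(2) s] by (auto simp: not_less[symmetric])
    then have "y \<in> B"
      using norm_triangle_ineq[of x "y - x"] by (simp add: B_def dist_norm norm_minus_commute)
    then show ?thesis
      using mult_right_mono[OF M(2)[of "s *\<^sub>R (x - y)"], of "\<bar>\<phi> x\<bar> * \<bar>g y\<bar>"] M(1) by (simp add: abs_mult mult_ac)
  qed auto
  have prod: "integrable (lborel \<Otimes>\<^sub>M lborel) (\<lambda>(x, y). ?G x y)"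
  proof (rule Bochner_Integration.integrable_bound)
    show "integrable (lborel \<Otimes>\<^sub>M lborel) (\<lambda>(x, y). M * (\<bar>\<phi> x\<bar> * (\<bar>g y\<bar> * indicator B y)))"
    proof (rule lborel_pair.Fubini_integrable)
      show "AE x in lborel. integrable lborel (\<lambda>y. case (x, y) of (x, y) \<Rightarrow> M * (\<bar>\<phi> x\<bar> * (\<bar>g y\<bar> * indicator B y)))"
        using gB by simp
      have "(\<lambda>x. LINT y|lborel. norm (case (x, y) of (x, y) \<Rightarrow> M * (\<bar>\<phi> x\<bar> * (\<bar>g y\<bar> * indicator B y))))
         = (\<lambda>x. \<bar>\<phi> x\<bar> * (M * (LINT y|lborel. \<bar>g y\<bar> * indicator B y)))"
        using M(1) by (auto simp: abs_mult)
      then show "integrable lborel (\<lambda>x. LINT y|lborel. norm (case (x, y) of (x, y) \<Rightarrow> M * (\<bar>\<phi> x\<bar> * (\<bar>g y\<bar> * indicator B y))))"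
        using \<phi>i by simp
    qed measurable
    show "AE p in lborel \<Otimes>\<^sub>M lborel. norm (case p of (x, y) \<Rightarrow> ?G x y) \<le> norm (case p of (x, y) \<Rightarrow> M * (\<bar>\<phi> x\<bar> * (\<bar>g y\<bar> * indicator B y)))"
      using dom by (intro AE_I2) (simp add: case_prod_beta)
  qed measurable
  have mc: "mconv g k s x = (LINT y|lborel. g y * k (s *\<^sub>R (x - y)))" for x
    unfolding mconv_def by (rule integral_completion) measurable
  have inner: "(LINT y|lborel. ?G x y) = mconv g k s x * \<phi> x" for x
    unfolding mc by simp
  have mm: "(\<lambda>x. mconv g k s x * \<phi> x) \<in> borel_measurable lborel"
    unfolding mc by measurable
  have "integrable lborel (\<lambda>x. mconv g k s x * \<phi> x)"
    using lborel_pair.integrable_fst[OF prod] by (simp only: inner)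
  then show "integrable lebesgue (\<lambda>x. mconv g k s x * \<phi> x)"
    using integrable_completion[OF mm] by simp
  have P: "(LINT z|lebesgue. k z * \<phi> (y + z /\<^sub>R s)) = (LINT z|lborel. k z * \<phi> (y + z /\<^sub>R s))" for y
    by (rule integral_completion) measurable
  show Pm: "(\<lambda>y. LINT z|lebesgue. k z * \<phi> (y + z /\<^sub>R s)) \<in> borel_measurable lborel"
    unfolding P by measurable
  have sub: "(LINT x|lborel. ?G x y) = g y * (LINT z|lborel. k z * \<phi> (y + z /\<^sub>R s)) / s ^ CARD('n)" for y
  proof -
    have "(LINT x|lborel. k (s *\<^sub>R (x - y)) * \<phi> x) = \<bar>1 / s\<bar> ^ DIM(real^'n) * (LINT z|lborel. k (s *\<^sub>R (y + (1 / s) *\<^sub>R z - y)) * \<phi> (y + (1 / s) *\<^sub>R z))"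
      using s by (intro lborel_integral_affine) auto
    also have "\<dots> = (LINT z|lborel. k z * \<phi> (y + z /\<^sub>R s)) / s ^ CARD('n)"
      using s by (simp add: power_one_over divide_inverse power_inverse)
    finally show ?thesis
      by (simp add: mult.assoc)
  qed
  have "(LINT x|lebesgue. mconv g k s x * \<phi> x) = (LINT x|lborel. LINT y|lborel. ?G x y)"
    unfolding inner by (rule integral_completion[OF mm])
  also have "\<dots> = (LINT y|lborel. LINT x|lborel. ?G x y)"
    by (rule lborel_pair.Fubini_integral[OF prod, symmetric])
  also have "\<dots> = (LINT y|lborel. g y * (LINT z|lebesgue. k z * \<phi> (y + z /\<^sub>R s))) / s ^ CARD('n)"
    unfolding sub P by simp
  also have "(LINT y|lborel. g y * (LINT z|lebesgue. k z * \<phi> (y + z /\<^sub>R s))) = (LINT y|lebesgue. g y * (LINT z|lebesgue. k z * \<phi> (y + z /\<^sub>R s)))"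
    by (rule integral_completion[symmetric, OF borel_measurable_times[OF g(1) Pm]])
  finally show "s ^ CARD('n) * (LINT x|lebesgue. mconv g k s x * \<phi> x)
      = (LINT y|lebesgue. g y * (LINT z|lebesgue. k z * \<phi> (y + z /\<^sub>R s)))"
    using s by simp
qed

text \<open>Once the mollification acts on \<phi>, continuity of \<phi> and dominated convergence
  suffice. The kernel is not normalised, so its mass remains as a factor.\<close>

lemma mconv_test_limit:
  fixes g :: "real^'n::finite \<Rightarrow> real"
  assumes g: "g \<in> borel_measurable lborel" "L2_loc g" and k: "test_fun k" and \<phi>: "test_fun \<phi>"
  shows "(\<lambda>n. real (Suc n) ^ CARD('n) * (LINT x|lebesgue. mconv g k (real (Suc n)) x * \<phi> x))
     \<longlonglongrightarrow> (LINT z|lebesgue. k z) * (LINT x|lebesgue. g x * \<phi> x)"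
proof -
  have [measurable]: "k \<in> borel_measurable borel" "\<phi> \<in> borel_measurable borel"
    using test_fun_continuous[OF k] test_fun_continuous[OF \<phi>] by (auto intro: borel_measurable_continuous_onI)
  obtain r1 where r1: "0 < r1" "\<And>z. r1 < norm z \<Longrightarrow> k z = 0"
    using test_fun_support[OF k] by blast
  obtain r2 where r2: "0 < r2" "\<And>z. r2 < norm z \<Longrightarrow> \<phi> z = 0"
    using test_fun_support[OF \<phi>] by blast
  obtain M where M: "0 < M" "\<And>z. \<bar>\<phi> z\<bar> \<le> M"
    using test_fun_bounded[OF \<phi>] by blast
  define P where "P n y = (LINT z|lebesgue. k z * \<phi> (y + z /\<^sub>R real (Suc n)))" for n y
  define c where "c = (LINT z|lebesgue. \<bar>k z\<bar>) * M"
  \<comment> \<open>One ball serves all \<open>n\<close>, since the scales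
    \<open>real (Suc n)\<close> are at least 1.\<close>
  define B where "B = cball (0 :: real^'n) (r2 + r1)"
  have km: "(\<lambda>z. k z * \<phi> (y + z /\<^sub>R s)) \<in> borel_measurable lebesgue" for y s
    by (rule measurable_completion) measurable
  have kint: "integrable lebesgue (\<lambda>z. \<bar>k z\<bar> * M)"
    using test_fun_integrable[OF k] by simp
  have kb: "norm (k z * \<phi> y) \<le> \<bar>k z\<bar> * M" for z y
    using M(2)[of y] by (simp add: abs_mult mult_left_mono)
  have ki: "integrable lebesgue (\<lambda>z. k z * \<phi> (y + z /\<^sub>R s))" for y s
    by (rule Bochner_Integration.integrable_bound[OF kint km])
      (use kb in \<open>auto intro!: AE_I2 intro: order.trans[OF _ abs_ge_self]\<close>)
  have Plim: "(\<lambda>n. P n y) \<longlonglongrightarrow> (LINT z|lebesgue. k z) * \<phi> y" for y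
  proof -
    have "(\<lambda>n. P n y) \<longlonglongrightarrow> (LINT z|lebesgue. k z * \<phi> y)"
      unfolding P_def
    proof (rule integral_dominated_convergence[OF _ _ kint])
      show "(\<lambda>z. k z * \<phi> y) \<in> borel_measurable lebesgue"
        by (rule measurable_completion) measurable
      show "AE z in lebesgue. (\<lambda>n. k z * \<phi> (y + z /\<^sub>R real (Suc n))) \<longlonglongrightarrow> k z * \<phi> y"
      proof (rule AE_I2)
        fix z
        have "(\<lambda>n. y + z /\<^sub>R real (Suc n)) \<longlonglongrightarrow> y + 0 *\<^sub>R z"
          by (intro tendsto_intros LIMSEQ_inverse_real_of_nat)
        moreover have "isCont \<phi> (y + 0 *\<^sub>R z)"
          using test_fun_continuous[OF \<phi>] by (simp add: continuous_on_eq_continuous_at)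
        ultimately have "(\<lambda>n. \<phi> (y + z /\<^sub>R real (Suc n))) \<longlonglongrightarrow> \<phi> (y + 0 *\<^sub>R z)"
          by (rule isCont_tendsto_compose[rotated])
        then show "(\<lambda>n. k z * \<phi> (y + z /\<^sub>R real (Suc n))) \<longlonglongrightarrow> k z * \<phi> y"
          by (intro tendsto_mult_left) simp
      qed
    qed (use km kb in auto)
    then show ?thesis by simp
  qed
  have Pb: "\<bar>P n y\<bar> \<le> c" for n y
  proof -
    have "\<bar>P n y\<bar> \<le> (LINT z|lebesgue. \<bar>k z * \<phi> (y + z /\<^sub>R real (Suc n))\<bar>)"
      unfolding P_def by (rule integral_abs_bound)
    also have "\<dots> \<le> (LINT z|lebesgue. \<bar>k z\<bar> * M)"
      using kb by (intro integral_mono kint integrable_abs ki) auto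
    finally show ?thesis by (simp add: c_def)
  qed
  have Pz: "P n y = 0" if "y \<notin> B" for n y
  proof -
    have "k z * \<phi> (y + z /\<^sub>R real (Suc n)) = 0" for z
    proof (cases "norm z \<le> r1")
      case True
      have "norm z * inverse (real (Suc n)) \<le> norm z * 1"
        by (intro mult_left_mono) (auto simp: field_simps)
      then have "norm (z /\<^sub>R real (Suc n)) \<le> r1" using True by (simp add: mult.commute)
      then have "r2 < norm (y + z /\<^sub>R real (Suc n))"
        using that norm_triangle_ineq4[of "y + z /\<^sub>R real (Suc n)" "z /\<^sub>R real (Suc n)"] by (simp add: B_def)
      then show ?thesis by (simp add: r2(2))
    qed (simp add: r1(2))
    then show ?thesis unfolding P_def by (simp only: Bochner_Integration.integral_zero)
  qed
  have "(\<lambda>n. LINT y|lebesgue. g y * P n y) \<longlonglongrightarrow> (LINT y|lebesgue. g y * ((LINT z|lebesgue. k z) * \<phi> y))"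
  proof (rule integral_dominated_convergence)
    show "integrable lebesgue (\<lambda>y. \<bar>indicator B y *\<^sub>R g y\<bar> * c)"
      using L2_loc_imp_set_integrable[OF g(2), of B] by (intro integrable_mult_left integrable_abs) (simp add: B_def set_integrable_def)
    show "(\<lambda>y. g y * ((LINT z|lebesgue. k z) * \<phi> y)) \<in> borel_measurable lebesgue"
      by (rule measurable_completion) (use g(1) in measurable)
    show "(\<lambda>y. g y * P n y) \<in> borel_measurable lebesgue" for n
      unfolding P_def by (rule measurable_completion[OF borel_measurable_times[OF g(1) mconv_test_integral(3)[OF g k \<phi>]]]) simp
    show "AE y in lebesgue. (\<lambda>n. g y * P n y) \<longlonglongrightarrow> g y * ((LINT z|lebesgue. k z) * \<phi> y)"
      by (intro AE_I2 tendsto_mult_left Plim)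
    show "AE y in lebesgue. norm (g y * P n y) \<le> \<bar>indicator B y *\<^sub>R g y\<bar> * c" for n
    proof (rule AE_I2)
      fix y
      show "norm (g y * P n y) \<le> \<bar>indicator B y *\<^sub>R g y\<bar> * c"
        using mult_left_mono[OF Pb[of n y], of "\<bar>g y\<bar>"] Pz[of y n] by (cases "y \<in> B") (auto simp: abs_mult)
    qed
  qed
  also have "(\<lambda>n. LINT y|lebesgue. g y * P n y) = (\<lambda>n. real (Suc n) ^ CARD('n) * (LINT x|lebesgue. mconv g k (real (Suc n)) x * \<phi> x))"
    unfolding P_def by (subst mconv_test_integral(2)[OF g k \<phi>]) auto
  also have "(LINT y|lebesgue. g y * ((LINT z|lebesgue. k z) * \<phi> y)) = (LINT z|lebesgue. k z) * (LINT x|lebesgue. g x * \<phi> x)"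
    by (subst mult.left_commute) simp
  finally show ?thesis .
qed

text \<open>Tested against any \<phi>, the mollifications tend to the mass of \<open>k\<close> times
  \<open>g\<close>, and by uniform closeness also to \<open>V\<close>. This identifies a classically
  obtained limit with a weak derivative known only to be \<open>L2_loc\<close>.\<close>

lemma mconv_limit_AE:
  fixes g :: "real^'n::finite \<Rightarrow> real"
  assumes g: "L2_loc g" and k: "test_fun k" and V: "continuous_on UNIV V" and \<epsilon>: "\<epsilon> \<longlonglongrightarrow> 0"
    and lim: "\<And>n x. \<bar>real (Suc n) ^ CARD('n) * mconv g k (real (Suc n)) x - V x\<bar> \<le> \<epsilon> n"
  shows "AE x in lebesgue. V x = (LINT z|lebesgue. k z) * g x"
proof -
  define c where "c = (LINT z|lebesgue. k z)"
  obtain g' where g': "g' \<in> borel_measurable lborel" and "AE x in lborel. g x = g' x"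
    using completion_ex_borel_measurable_real g unfolding L2_loc_def by blast
  then have eq: "AE x in lebesgue. g x = g' x"
    by (intro AE_completion)
  have gm: "g \<in> borel_measurable lebesgue" and gm': "g' \<in> borel_measurable lebesgue"
    using g g' by (auto simp: L2_loc_def intro: measurable_completion)
  have mg: "mconv g k s = mconv g' k s" for s
    using mconv_cong_AE[OF eq gm gm' k] by blast
  have L2': "L2_loc g'"
    unfolding L2_loc_def set_integrable_def
  proof (intro conjI gm' allI impI)
    fix K :: "(real^'n) set" assume K: "compact K"
    then have "integrable lebesgue (\<lambda>x. indicator K x *\<^sub>R (g x)\<^sup>2)"
      using g by (simp add: L2_loc_def set_integrable_def)
    moreover have "(\<lambda>x. indicator K x *\<^sub>R (g' x)\<^sup>2) \<in> borel_measurable lebesgue"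
      using K gm' by (intro borel_measurable_scaleR borel_measurable_indicator borel_measurable_power)
        (auto dest: compact_imp_closed)
    ultimately show "integrable lebesgue (\<lambda>x. indicator K x *\<^sub>R (g' x)\<^sup>2)"
      by (rule integrable_cong_AE_imp) (use eq in \<open>auto elim: AE_mp\<close>)
  qed
  have Vm: "V \<in> borel_measurable lebesgue"
    using V by (rule borel_measurable_lebesgue_continuous)
  have VL2: "L2_loc V"
    unfolding L2_loc_def set_integrable_def
  proof (intro conjI Vm allI impI)
    fix K :: "(real^'n) set" assume K: "compact K"
    then have "compact (V ` K)"
      by (intro compact_continuous_image continuous_on_subset[OF V]) auto
    then obtain M where "\<And>x. x \<in> K \<Longrightarrow> \<bar>V x\<bar> \<le> M"
      by (metis compact_imp_bounded bounded_iff imageI real_norm_def)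
    then have "\<And>x. x \<in> K \<Longrightarrow> \<bar>V x\<bar> \<le> \<bar>M\<bar>"
      using abs_ge_self order.trans by blast
    moreover obtain r where "K \<subseteq> cball 0 r"
      using compact_imp_bounded[OF K] by (auto simp: bounded_iff subset_iff)
    moreover have "(\<lambda>x. indicator K x *\<^sub>R (V x)\<^sup>2) \<in> borel_measurable lebesgue"
      using K Vm by (intro borel_measurable_scaleR borel_measurable_indicator borel_measurable_power)
        (auto dest: compact_imp_closed)
    ultimately show "integrable lebesgue (\<lambda>x. indicator K x *\<^sub>R (V x)\<^sup>2)"
      by (intro integrable_bounded_support[of _ "M\<^sup>2" 0 r]) (auto simp: indicator_def abs_le_square_iff[symmetric])
  qed
  have test: "(LINT x|lebesgue. V x * \<phi> x) = c * (LINT x|lebesgue. g' x * \<phi> x)" if \<phi>: "test_fun \<phi>" for \<phi>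
  proof (rule LIMSEQ_unique)
    show "(\<lambda>n. real (Suc n) ^ CARD('n) * (LINT x|lebesgue. mconv g' k (real (Suc n)) x * \<phi> x)) \<longlonglongrightarrow> c * (LINT x|lebesgue. g' x * \<phi> x)"
      unfolding c_def by (rule mconv_test_limit[OF g' L2' k \<phi>])
    have Vi: "integrable lebesgue (\<lambda>x. V x * \<phi> x)"
      by (rule L2_loc_times_test_fun[OF VL2 \<phi>])
    have "\<bar>real (Suc n) ^ CARD('n) * (LINT x|lebesgue. mconv g' k (real (Suc n)) x * \<phi> x) - (LINT x|lebesgue. V x * \<phi> x)\<bar>
       \<le> \<epsilon> n * (LINT x|lebesgue. \<bar>\<phi> x\<bar>)" for n
    proof -
      define a where "a x = real (Suc n) ^ CARD('n) * mconv g' k (real (Suc n)) x" for x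
      have ai: "integrable lebesgue (\<lambda>x. a x * \<phi> x)"
        using mconv_test_integral(1)[OF g' L2' k \<phi>, of "real (Suc n)"] by (simp add: a_def mult.assoc)
      have "real (Suc n) ^ CARD('n) * (LINT x|lebesgue. mconv g' k (real (Suc n)) x * \<phi> x) - (LINT x|lebesgue. V x * \<phi> x)
         = (LINT x|lebesgue. (a x - V x) * \<phi> x)"
        using ai Vi by (simp add: left_diff_distrib) (simp add: a_def mult.assoc)
      also have "\<bar>\<dots>\<bar> \<le> (LINT x|lebesgue. \<bar>(a x - V x) * \<phi> x\<bar>)"
        by (rule integral_abs_bound)
      also have "\<dots> \<le> (LINT x|lebesgue. \<epsilon> n * \<bar>\<phi> x\<bar>)"
      proof (rule integral_mono)
        have "integrable lebesgue (\<lambda>x. (a x - V x) * \<phi> x)"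
          using ai Vi by (simp add: left_diff_distrib)
        then show "integrable lebesgue (\<lambda>x. \<bar>(a x - V x) * \<phi> x\<bar>)"
          by (rule integrable_abs)
        show "integrable lebesgue (\<lambda>x. \<epsilon> n * \<bar>\<phi> x\<bar>)"
          using test_fun_integrable[OF \<phi>] by simp
        show "\<bar>(a x - V x) * \<phi> x\<bar> \<le> \<epsilon> n * \<bar>\<phi> x\<bar>" for x
          using lim[of n x] unfolding abs_mult a_def mg by (rule mult_right_mono) simp
      qed
      finally show ?thesis by simp
    qed
    then have "\<forall>\<^sub>F n in sequentially. norm (real (Suc n) ^ CARD('n) * (LINT x|lebesgue. mconv g' k (real (Suc n)) x * \<phi> x) - (LINT x|lebesgue. V x * \<phi> x))
       \<le> \<epsilon> n * (LINT x|lebesgue. \<bar>\<phi> x\<bar>)"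
      by (intro always_eventually) simp
    moreover have "(\<lambda>n. \<epsilon> n * (LINT x|lebesgue. \<bar>\<phi> x\<bar>)) \<longlonglongrightarrow> 0"
      using tendsto_mult_left_zero[OF \<epsilon>] .
    ultimately show "(\<lambda>n. real (Suc n) ^ CARD('n) * (LINT x|lebesgue. mconv g' k (real (Suc n)) x * \<phi> x)) \<longlonglongrightarrow> (LINT x|lebesgue. V x * \<phi> x)"
      by (rule LIM_zero_cancel[OF Lim_null_comparison])
  qed
  have "AE x in lebesgue. V x - c * g' x = 0"
  proof (rule AE_eq_0_if_test_integrals_0)
    show "(\<lambda>x. V x - c * g' x) \<in> borel_measurable lebesgue"
      using Vm gm' by simp
    show "set_integrable lebesgue K (\<lambda>x. V x - c * g' x)" if "compact K" for K
      using that by (intro set_integral_diff(1) set_integrable_mult_right L2_loc_imp_set_integrable VL2 L2')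
    show "(LINT x|lebesgue. (V x - c * g' x) * \<phi> x) = 0" if "test_fun \<phi>" for \<phi>
      using test[OF that] L2_loc_times_test_fun[OF VL2 that] L2_loc_times_test_fun[OF L2' that]
      by (simp add: left_diff_distrib mult.assoc)
  qed
  with eq show ?thesis
    unfolding c_def by eventually_elim simp
qed

section \<open>Dependence on the scale\<close>

lemma partial_sum: "(\<And>i. i \<in> I \<Longrightarrow> g i differentiable (at x)) \<Longrightarrow>
    partial l (\<lambda>x. \<Sum>i\<in>I. g i x) x = (\<Sum>i\<in>I. partial l (g i) x)"
proof (induction I rule: infinite_finite_induct)
  case (insert i I)
  then show ?case by (simp add: partial_add)
qed auto

definition elliptic :: "('n \<Rightarrow> 'n \<Rightarrow> real) \<Rightarrow> (real^'n::finite \<Rightarrow> real) \<Rightarrow> real^'n \<Rightarrow> real" where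
  "elliptic a k z = (\<Sum>i\<in>UNIV. \<Sum>j\<in>UNIV. a i j * partial i (partial j k) z)"

text \<open>For \<open>k = \<partial>\<^sup>\<alpha>\<eta>\<close>, \<open>\<kappa> = \<partial>\<^sup>\<alpha>\<psi>\<close> and \<open>m = |\<alpha>|\<close>.\<close>

definition scaling_pair :: "('n \<Rightarrow> 'n \<Rightarrow> real) \<Rightarrow> nat \<Rightarrow> (real^'n::finite \<Rightarrow> real) \<Rightarrow> (real^'n \<Rightarrow> real) \<Rightarrow> bool" where
  "scaling_pair a m k \<kappa> \<longleftrightarrow> (\<forall>z. real (CARD('n) + m) * k z + (\<Sum>i\<in>UNIV. z $ i * partial i k z) = - elliptic a \<kappa> z)"

text \<open>The commutator of the l-th partial derivative with z . grad is that same partial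
  derivative, which raises \<open>m\<close> by one. The elliptic operator commutes with it because
  the coefficients are constant.\<close>

lemma scaling_pair_partial:
  fixes K L :: "'p::topological_space \<Rightarrow> real^'n::finite \<Rightarrow> real"
  assumes K: "smooth_family K" and L: "smooth_family L" and c: "scaling_pair a m (K p) (L p)"
  shows "scaling_pair a (Suc m) (partial l (K p)) (partial l (L p))"
proof -
  note d = smooth_family_imp_differentiable
  have eq: "(\<lambda>z. real (CARD('n) + m) * K p z + (\<Sum>i\<in>UNIV. z $ i * partial i (K p) z))
      = (\<lambda>z. (-1) * (\<Sum>i\<in>UNIV. \<Sum>j\<in>UNIV. a i j * partial i (partial j (L p)) z))"
    using c by (auto simp: scaling_pair_def elliptic_def)
  have lhs: "partial l (\<lambda>z. real (CARD('n) + m) * K p z + (\<Sum>i\<in>UNIV. z $ i * partial i (K p) z)) z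
      = real (CARD('n) + Suc m) * partial l (K p) z + (\<Sum>i\<in>UNIV. z $ i * partial i (partial l (K p)) z)" for z
  proof -
    have "(\<lambda>z. z $ i * partial i (K p) z) differentiable (at z)" for i
      by (rule d[where G = "\<lambda>p z. z $ i * partial i (K p) z"]) (intro smooth_family.mult smooth_family.coord smooth_family_partial K)
    moreover from this have "(\<lambda>z. \<Sum>i\<in>UNIV. z $ i * partial i (K p) z) differentiable (at z)"
      by (intro differentiable_sum) auto
    ultimately have "partial l (\<lambda>z. real (CARD('n) + m) * K p z + (\<Sum>i\<in>UNIV. z $ i * partial i (K p) z)) z
      = real (CARD('n) + m) * partial l (K p) z + (\<Sum>i\<in>UNIV. partial l (\<lambda>z. z $ i * partial i (K p) z) z)"
      using d[OF K] by (simp add: partial_add partial_cmult partial_sum)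
    also have "(\<Sum>i\<in>UNIV. partial l (\<lambda>z. z $ i * partial i (K p) z) z)
        = (\<Sum>i\<in>UNIV. z $ i * partial i (partial l (K p)) z + (if i = l then partial l (K p) z else 0))"
    proof (intro sum.cong refl)
      fix i
      have "partial l (\<lambda>z. z $ i * partial i (K p) z) z = z $ i * partial l (partial i (K p)) z + partial l (\<lambda>z. z $ i) z * partial i (K p) z"
        by (rule partial_mult[OF d[OF smooth_family.coord] d[OF smooth_family_partial[OF K]]])
      then show "partial l (\<lambda>z. z $ i * partial i (K p) z) z = z $ i * partial i (partial l (K p)) z + (if i = l then partial l (K p) z else 0)"
        unfolding smooth_family_partial_commute[OF K, of l i] by simp
    qed
    finally show ?thesis
      by (simp add: sum.distrib distrib_right)
  qed
  have rhs: "partial l (\<lambda>z. (-1) * (\<Sum>i\<in>UNIV. \<Sum>j\<in>UNIV. a i j * partial i (partial j (L p)) z)) z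
      = - elliptic a (partial l (L p)) z" for z
  proof -
    have dd: "(\<lambda>z. a i j * partial i (partial j (L p)) z) differentiable (at z)" for i j
      by (rule d[where G = "\<lambda>p z. a i j * partial i (partial j (L p)) z"]) (intro smooth_family.mult smooth_family_real smooth_family_partial L)
    have comm: "partial l (partial i (partial j (L p))) = partial i (partial j (partial l (L p)))" for i j
      by (simp add: smooth_family_partial_commute[OF smooth_family_partial[OF L], of l i] smooth_family_partial_commute[OF L, of l j])
    have ds: "(\<lambda>z. \<Sum>i\<in>UNIV. \<Sum>j\<in>UNIV. a i j * partial i (partial j (L p)) z) differentiable (at z)"
      using dd by (intro differentiable_sum) auto
    have "partial l (\<lambda>z. \<Sum>i\<in>UNIV. \<Sum>j\<in>UNIV. a i j * partial i (partial j (L p)) z) z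
        = (\<Sum>i\<in>UNIV. \<Sum>j\<in>UNIV. partial l (\<lambda>z. a i j * partial i (partial j (L p)) z) z)"
      using dd by (simp add: partial_sum differentiable_sum)
    also have "\<dots> = elliptic a (partial l (L p)) z"
      using d[OF smooth_family_partial[OF smooth_family_partial[OF L]]] by (simp add: partial_cmult comm elliptic_def)
    finally show ?thesis
      using partial_cmult[OF ds, of l "-1"] by simp
  qed
  show ?thesis
    unfolding scaling_pair_def using lhs rhs unfolding eq by simp
qed

text \<open>This is where the differential equation enters: the two derivatives on the kernel pass
  to \<open>u\<close> with a factor \<open>s\<^sup>2\<close>, and the resulting combination of weak
  derivatives equals \<open>f\<close> almost everywhere.\<close>

lemma mconv_elliptic:
  assumes g2: "\<And>i j. L2_loc (g2 i j)" "\<And>i j. weak_deriv2 i j u (g2 i j)"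
    and eq: "AE x in lebesgue. (\<Sum>i\<in>UNIV. \<Sum>j\<in>UNIV. a i j * g2 i j x) = f x"
    and u: "u \<in> borel_measurable lebesgue" "\<And>y. \<bar>u y\<bar> \<le> W" and f: "f \<in> borel_measurable lebesgue"
    and \<kappa>: "test_fun \<kappa>" and s: "0 < s"
  shows "s\<^sup>2 * mconv u (elliptic a \<kappa>) s x = mconv f \<kappa> s x"
proof -
  have int_u: "integrable lebesgue (\<lambda>y. u y * partial i (partial j \<kappa>) (s *\<^sub>R (x - y)))" for i j
    using mconv_integrable[OF u test_fun_partial[OF test_fun_partial[OF \<kappa>]] s] .
  have int_g: "integrable lebesgue (\<lambda>y. g2 i j y * \<kappa> (s *\<^sub>R (x - y)))" for i j
    using L2_loc_times_test_fun[OF g2(1) test_fun_affine[OF \<kappa>]] s by simp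
  have "mconv u (elliptic a \<kappa>) s x
      = (LINT y|lebesgue. (\<Sum>i\<in>UNIV. \<Sum>j\<in>UNIV. a i j * (u y * partial i (partial j \<kappa>) (s *\<^sub>R (x - y)))))"
    by (simp add: mconv_def elliptic_def sum_distrib_left mult.left_commute)
  also have "\<dots> = (\<Sum>i\<in>UNIV. \<Sum>j\<in>UNIV. a i j * mconv u (partial i (partial j \<kappa>)) s x)"
    using int_u by (simp add: mconv_def)
  finally have "s\<^sup>2 * mconv u (elliptic a \<kappa>) s x
      = (\<Sum>i\<in>UNIV. \<Sum>j\<in>UNIV. a i j * (s\<^sup>2 * mconv u (partial i (partial j \<kappa>)) s x))"
    by (simp add: sum_distrib_left mult.left_commute)
  also have "\<dots> = (\<Sum>i\<in>UNIV. \<Sum>j\<in>UNIV. a i j * mconv (g2 i j) \<kappa> s x)"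
    by (simp add: mconv_weak_deriv2[OF g2(2) \<kappa> s])
  also have "\<dots> = mconv (\<lambda>x. \<Sum>i\<in>UNIV. \<Sum>j\<in>UNIV. a i j * g2 i j x) \<kappa> s x"
    using int_g by (simp add: mconv_def sum_distrib_right mult.assoc)
  also have "\<dots> = mconv f \<kappa> s x"
  proof (rule mconv_cong_AE[OF eq _ f \<kappa>])
    have "g2 i j \<in> borel_measurable lebesgue" for i j
      using g2(1)[of i j] by (simp add: L2_loc_def)
    then show "(\<lambda>x. \<Sum>i\<in>UNIV. \<Sum>j\<in>UNIV. a i j * g2 i j x) \<in> borel_measurable lebesgue"
      by (intro borel_measurable_sum borel_measurable_times borel_measurable_const)
  qed
  finally show ?thesis .
qed

text \<open>The product rule produces exactly the left-hand side of \<open>scaling_pair\<close>,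
  with \<open>s ^ (CARD('n) + m) / s\<close> in front. The kernel becomes
  \<open>elliptic a \<kappa>\<close> with a minus sign, and trading it for \<open>f\<close> costs
  another \<open>s\<^sup>2\<close>.\<close>

lemma mconv_scale_derivative:
  fixes u f :: "real^'n::finite \<Rightarrow> real"
  assumes u: "u \<in> borel_measurable lebesgue" "\<And>y. \<bar>u y\<bar> \<le> W"
    and k: "test_fun k" and \<kappa>: "test_fun \<kappa>" and s: "0 < s" and c: "scaling_pair a m k \<kappa>"
    and weak: "s\<^sup>2 * mconv u (elliptic a \<kappa>) s x = mconv f \<kappa> s x"
  shows "((\<lambda>s. s ^ (CARD('n) + m) * mconv u k s x) has_real_derivative
     - (s ^ (CARD('n) + m) / s ^ 3 * mconv f \<kappa> s x)) (at s)"
proof -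
  let ?N = "CARD('n) + m"
  define D where "D z = (\<Sum>i\<in>UNIV. z $ i * partial i k z)" for z
  have "elliptic a \<kappa> = (\<lambda>z. - (real ?N * k z + D z))"
    using c by (auto simp: scaling_pair_def D_def)
  moreover have "integrable lebesgue (\<lambda>y. u y * k (s *\<^sub>R (x - y)))"
    by (rule mconv_integrable[OF u k s])
  \<comment> \<open>\<open>D\<close> has not been shown to be a test function; integrability is read
    off from the scaling identity, which expresses it through \<open>k\<close> and second
    derivatives of \<kappa>.\<close>
  moreover have "integrable lebesgue (\<lambda>y. u y * D (s *\<^sub>R (x - y)))"
  proof -
    have "integrable lebesgue (\<lambda>y. \<Sum>i\<in>UNIV. \<Sum>j\<in>UNIV. a i j * (u y * partial i (partial j \<kappa>) (s *\<^sub>R (x - y))))"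
      by (intro Bochner_Integration.integrable_sum integrable_mult_right
          mconv_integrable[OF u test_fun_partial[OF test_fun_partial[OF \<kappa>]] s])
    then have "integrable lebesgue (\<lambda>y. u y * elliptic a \<kappa> (s *\<^sub>R (x - y)))"
      by (simp add: elliptic_def sum_distrib_left mult.left_commute)
    moreover have "(\<lambda>y. u y * D (s *\<^sub>R (x - y)))
        = (\<lambda>y. - (u y * elliptic a \<kappa> (s *\<^sub>R (x - y))) - real ?N * (u y * k (s *\<^sub>R (x - y))))"
    proof
      fix y
      have "D (s *\<^sub>R (x - y)) = - elliptic a \<kappa> (s *\<^sub>R (x - y)) - real ?N * k (s *\<^sub>R (x - y))"
        using c unfolding scaling_pair_def D_def[symmetric] by (simp only: eq_diff_eq add.commute)
      then show "u y * D (s *\<^sub>R (x - y)) = - (u y * elliptic a \<kappa> (s *\<^sub>R (x - y))) - real ?N * (u y * k (s *\<^sub>R (x - y)))"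
        by (simp only: right_diff_distrib mult_minus_right mult.left_commute)
    qed
    ultimately show ?thesis
      using mconv_integrable[OF u k s]
      by (simp only: Bochner_Integration.integrable_diff Bochner_Integration.integrable_minus integrable_mult_right)
  qed
  moreover have "u y * - (real ?N * k z + D z) = - real ?N * (u y * k z) - u y * D z" for y z
    by (simp add: algebra_simps)
  ultimately have e: "mconv u (elliptic a \<kappa>) s x = - (real ?N * mconv u k s x + mconv u D s x)"
    by (simp only: mconv_def Bochner_Integration.integral_diff integrable_mult_right integral_mult_right_zero)
  have "((\<lambda>s. s ^ ?N * mconv u k s x) has_real_derivative
      real ?N * s ^ (?N - 1) * mconv u k s x + s ^ ?N * (mconv u D s x / s)) (at s)"
    by (rule DERIV_cong[OF DERIV_mult[OF DERIV_pow mconv_has_derivative_scale[OF u k s, folded D_def]]]) simp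
  also have "real ?N * s ^ (?N - 1) * mconv u k s x + s ^ ?N * (mconv u D s x / s)
      = s ^ ?N / s * (real ?N * mconv u k s x + mconv u D s x)"
    using s power_eq_if[of s ?N] by (simp add: field_simps)
  also have "\<dots> = - (s ^ ?N / s ^ 3 * (s\<^sup>2 * mconv u (elliptic a \<kappa>) s x))"
    using s unfolding e by (simp add: field_simps power2_eq_square power3_eq_cube)
  finally show ?thesis unfolding weak .
qed

text \<open>The Cauchy criterion along the integers gives the limit, and letting \<open>t\<close>
  tend to infinity in the increment bound keeps the rate \<open>e s\<close> for all real
  scales.\<close>

lemma limit_at_top_if_increments_bounded:
  fixes U e :: "real \<Rightarrow> real"
  assumes U: "\<And>s t. 0 < s \<Longrightarrow> s \<le> t \<Longrightarrow> \<bar>U t - U s\<bar> \<le> e s" and e: "(e \<longlongrightarrow> 0) at_top"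
  obtains L where "\<And>s. 0 < s \<Longrightarrow> \<bar>U s - L\<bar> \<le> e s"
proof -
  have e': "(\<lambda>n. e (real (Suc n))) \<longlonglongrightarrow> 0"
    using filterlim_compose[OF e filterlim_compose[OF filterlim_real_sequentially filterlim_Suc]] .
  have "Cauchy (\<lambda>n. U (real (Suc n)))"
  proof (rule metric_CauchyI)
    fix \<epsilon> :: real assume "0 < \<epsilon>"
    then have "\<forall>\<^sub>F n in sequentially. e (real (Suc n)) < \<epsilon> / 2"
      using order_tendstoD(2)[OF e', of "\<epsilon> / 2"] by simp
    then obtain N where N: "e (real (Suc N)) < \<epsilon> / 2"
      by (auto simp: eventually_sequentially)
    have "\<bar>U (real (Suc n)) - U (real (Suc N))\<bar> < \<epsilon> / 2" if "n \<ge> N" for n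
      using U[of "real (Suc N)" "real (Suc n)"] N that by simp
    then have "dist (U (real (Suc m))) (U (real (Suc n))) < \<epsilon>" if "m \<ge> N" "n \<ge> N" for m n
      using that unfolding dist_real_def by (smt (verit) field_sum_of_halves)
    then show "\<exists>M. \<forall>m\<ge>M. \<forall>n\<ge>M. dist (U (real (Suc m))) (U (real (Suc n))) < \<epsilon>"
      by blast
  qed
  then obtain L where L: "(\<lambda>n. U (real (Suc n))) \<longlonglongrightarrow> L"
    using Cauchy_convergent convergentD by blast
  show thesis
  proof (rule that)
    fix s :: real assume "0 < s"
    have "(\<lambda>n. \<bar>U s - U (real (Suc n))\<bar>) \<longlonglongrightarrow> \<bar>U s - L\<bar>"
      by (intro tendsto_intros L)
    moreover have "\<forall>\<^sub>F n in sequentially. \<bar>U s - U (real (Suc n))\<bar> \<le> e s"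
      using eventually_ge_at_top[of "nat \<lceil>s\<rceil>"]
    proof eventually_elim
      case (elim n)
      then have "s \<le> real (Suc n)" by linarith
      with \<open>0 < s\<close> show ?case using U[of s "real (Suc n)"] by (simp add: abs_minus_commute)
    qed
    ultimately show "\<bar>U s - L\<bar> \<le> e s"
      by (intro tendsto_upperbound) auto
  qed
qed

text \<open>For \<open>m\<close> = 1, 2, 3 the exponent \<gamma> is - 1 - \<delta>, - \<delta> and 1
  - \<delta>. Its sign decides at which end of the scale axis the bound is useful: large
  \<open>s\<close> in the first two cases, small \<open>s\<close> in the third.\<close>

lemma mconv_scale_increment:
  fixes u f :: "real^'n::finite \<Rightarrow> real"
  assumes u: "u \<in> borel_measurable lebesgue" "\<And>y. \<bar>u y\<bar> \<le> W"
    and k: "test_fun k" and \<kappa>: "test_fun \<kappa>" and c: "scaling_pair a m k \<kappa>"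
    and weak: "\<And>s. 0 < s \<Longrightarrow> s\<^sup>2 * mconv u (elliptic a \<kappa>) s x = mconv f \<kappa> s x"
    and bnd: "\<And>s. 0 < s \<Longrightarrow> \<bar>mconv f \<kappa> s x\<bar> \<le> A / s ^ CARD('n) * s powr (-\<delta>)"
    and \<gamma>: "\<gamma> = real m - 2 - \<delta>" "\<gamma> \<noteq> 0" and st: "0 < s" "s \<le> t"
  shows "\<bar>t ^ (CARD('n) + m) * mconv u k t x - s ^ (CARD('n) + m) * mconv u k s x\<bar> \<le> A * (t powr \<gamma> - s powr \<gamma>) / \<gamma>"
proof (rule powr_increment_bound[OF _ _ \<gamma>(2) st, where F' = "\<lambda>s. - (s ^ (CARD('n) + m) / s ^ 3 * mconv f \<kappa> s x)"])
  fix r :: real assume r: "0 < r"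
  show "((\<lambda>t. t ^ (CARD('n) + m) * mconv u k t x) has_real_derivative - (r ^ (CARD('n) + m) / r ^ 3 * mconv f \<kappa> r x)) (at r)"
    by (rule mconv_scale_derivative[OF u k \<kappa> r c weak[OF r]])
  have "\<bar>- (r ^ (CARD('n) + m) / r ^ 3 * mconv f \<kappa> r x)\<bar> \<le> r ^ (CARD('n) + m) / r ^ 3 * (A / r ^ CARD('n) * r powr (-\<delta>))"
    using bnd[OF r] r by (simp add: abs_mult mult_left_mono del: times_divide_eq_left)
  also have "\<dots> = A * (r ^ m / r ^ 3 * r powr (-\<delta>))"
    using r by (simp add: power_add)
  also have "r ^ m / r ^ 3 * r powr (-\<delta>) = r powr (\<gamma> - 1)"
  proof -
    have "r ^ m / r ^ 3 * r powr (-\<delta>) = r powr real m / r powr real 3 * r powr (-\<delta>)"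
      using r by (simp only: powr_realpow)
    also have "\<dots> = r powr (real m - real 3 + -\<delta>)"
      by (simp only: powr_diff powr_add)
    also have "real m - real 3 + -\<delta> = \<gamma> - 1"
      unfolding \<gamma>(1) by simp
    finally show ?thesis .
  qed
  finally show "\<bar>- (r ^ (CARD('n) + m) / r ^ 3 * mconv f \<kappa> r x)\<bar> \<le> A * r powr (\<gamma> - 1)" .
qed

lemma has_derivative_norm_bound:
  fixes g :: "real^'n::finite \<Rightarrow> real"
  assumes g: "\<And>x. (g has_derivative (\<lambda>h. \<Sum>i\<in>UNIV. h $ i * G i x)) (at x)" and G: "\<And>i x. \<bar>G i x\<bar> \<le> C"
  shows "\<bar>g x - g y\<bar> \<le> real CARD('n) * C * norm (x - y)"
proof -
  have "onorm (\<lambda>h. \<Sum>i\<in>UNIV. h $ i * G i z) \<le> real CARD('n) * C" for z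
  proof (rule onorm_bound)
    show "0 \<le> real CARD('n) * C"
      using order.trans[OF abs_ge_zero G] by simp
    fix h :: "real^'n"
    have "\<bar>\<Sum>i\<in>UNIV. h $ i * G i z\<bar> \<le> (\<Sum>i\<in>(UNIV::'n set). norm h * C)"
      by (intro order.trans[OF sum_abs] sum_mono) (simp add: abs_mult, intro mult_mono component_le_norm_cart G, auto)
    then show "norm (\<Sum>i\<in>UNIV. h $ i * G i z) \<le> real CARD('n) * C * norm h"
      by (simp add: mult_ac)
  qed
  then have "norm (g x - g y) \<le> real CARD('n) * C * norm (x - y)"
    by (intro differentiable_bound[of UNIV g "\<lambda>x h. \<Sum>i\<in>UNIV. h $ i * G i x"]) (auto intro: g)
  then show ?thesis by simp
qed

lemma higher_partial_zero_outside:
  "(\<And>z. r < norm z \<Longrightarrow> g z = 0) \<Longrightarrow> r < norm z \<Longrightarrow> higher_partial xs g z = 0"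
  by (induction xs arbitrary: z) (auto intro: partial_zero_outside[of r])

section \<open>The Hoelder estimate for the limit of the mollified derivative\<close>

text \<open>The function \<open>g\<close> is left unnormalised: it will turn out to be the
  derivative D_j u times the mass of \<open>K b\<close>. The first conclusion keeps the rate of
  convergence so that this can be checked afterwards.\<close>

lemma partial_schauder_core:
  fixes u f :: "real^'n::finite \<Rightarrow> real" and K L :: "'p::topological_space \<Rightarrow> real^'n \<Rightarrow> real"
  assumes u: "u \<in> borel_measurable lebesgue" "\<And>y. \<bar>u y\<bar> \<le> W"
    and f: "f \<in> borel_measurable lebesgue" "\<And>y. \<bar>f y\<bar> \<le> F"
    and K: "smooth_family K" and L: "smooth_family L" and c: "scaling_pair a 0 (K b) (L b)"
    and r: "0 \<le> r" "\<And>z. r < norm z \<Longrightarrow> K b z = 0" "\<And>z. r < norm z \<Longrightarrow> L b z = 0"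
    and weak: "\<And>\<kappa> s x. test_fun \<kappa> \<Longrightarrow> 0 < s \<Longrightarrow> s\<^sup>2 * mconv u (elliptic a \<kappa>) s x = mconv f \<kappa> s x"
    and hoelder: "\<And>y t. 0 < t \<Longrightarrow> \<bar>f (t *\<^sub>R axis j 1 + y) - f y\<bar> \<le> H * t powr \<delta>" and \<delta>: "0 < \<delta>" "\<delta> < 1"
    and M: "\<And>xs z. length xs \<le> 3 \<Longrightarrow> \<bar>higher_partial xs (L b) z\<bar> \<le> M"
  defines "A \<equiv> 2 * H * M * (measure lborel (ball (0 :: real^'n) 1) * r ^ CARD('n))"
  obtains g G where
    "\<And>s x. 0 < s \<Longrightarrow> \<bar>s ^ (CARD('n) + 1) * mconv u (partial j (K b)) s x - g x\<bar> \<le> A / (1 + \<delta>) * s powr (- 1 - \<delta>)"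
    "\<And>x. (g has_derivative (\<lambda>h. \<Sum>i\<in>UNIV. h $ i * G i x)) (at x)"
    "\<And>i x y. \<bar>G i x - G i y\<bar> \<le> (2 / \<delta> + real CARD('n) / (1 - \<delta>)) * A * norm (x - y) powr \<delta>"
proof -
  have hp: "smooth_family (\<lambda>p. higher_partial xs (K p))" "smooth_family (\<lambda>p. higher_partial xs (L p))" for xs
    using smooth_family_higher_partial K L by blast+
  have zero: "higher_partial xs (K b) z = 0" "higher_partial xs (L b) z = 0" if "r < norm z" for xs z
    using that r by (auto intro: higher_partial_zero_outside[of r])
  have test: "test_fun (higher_partial xs (K b))" "test_fun (higher_partial xs (L b))" for xs
    using zero[where xs=xs] by (auto intro!: test_funI[of _ r] smooth_family_smooth[OF hp(1)] smooth_family_smooth[OF hp(2)])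
  have c': "scaling_pair a (length xs) (higher_partial xs (K b)) (higher_partial xs (L b))" for xs
    by (induction xs) (auto intro: c scaling_pair_partial[OF hp])
  \<comment> \<open>The direction \<open>j\<close> stays outermost, where the Hoelder bound needs
    it, while new indices join \<open>xs\<close>.\<close>
  have swap: "partial l (partial j (higher_partial xs (K b))) = partial j (higher_partial (l # xs) (K b))" for l xs
    using smooth_family_partial_commute[OF hp(1)] by simp
  have bnd: "\<bar>mconv f (higher_partial (j # xs) (L b)) s x\<bar> \<le> A / s ^ CARD('n) * s powr (-\<delta>)"
    if "0 < s" "length xs \<le> 2" for xs s x
    unfolding A_def higher_partial.simps using that M[of xs] M[of "j # xs"] zero(2)[where xs = xs]
    by (intro mconv_partial_bound[OF f test(2) _ hoelder \<delta>(1) _ _ r(1)]) auto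
  \<comment> \<open>The derivative along \<open>xs\<close> of the j-th derivative of the normalised
    mollification: each spatial derivative contributes one power of \<open>s\<close>.\<close>
  define U where "U xs s x = s ^ (CARD('n) + Suc (length xs)) * mconv u (partial j (higher_partial xs (K b))) s x" for xs s x
  have U: "\<bar>U xs t x - U xs s x\<bar> \<le> A * (t powr \<gamma> - s powr \<gamma>) / \<gamma>"
    if "length xs \<le> 2" "\<gamma> = real (Suc (length xs)) - 2 - \<delta>" "0 < s" "s \<le> t" for xs \<gamma> s t x
    unfolding U_def using that \<delta>
    by (intro mconv_scale_increment[OF u _ _ _ weak bnd[of _ xs]])
      (use test[of "j # xs"] c'[of "j # xs"] in auto)
  have A0: "0 \<le> A"
    using order.trans[OF abs_ge_zero bnd[of 1 "[]" 0]] by simp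
  have dU: "((\<lambda>x. U xs s x) has_derivative (\<lambda>h. \<Sum>i\<in>UNIV. h $ i * U (i # xs) s x)) (at x)" if "0 < s" for xs s x
  proof -
    have "test_fun (partial j (higher_partial xs (K b)))"
      using test(1)[of "j # xs"] by simp
    from has_derivative_mult_right[OF mconv_has_derivative_space[OF u this that], of "s ^ (CARD('n) + Suc (length xs))" x]
    show ?thesis unfolding U_def swap by (simp add: sum_distrib_left mult_ac)
  qed
  \<comment> \<open>Positivity of \<beta> restricts this to at most one index in \<open>xs\<close>,
    that is, to the function and its gradient.\<close>
  have lim: "\<exists>g. \<forall>s>0. \<bar>U xs s x - g\<bar> \<le> A / \<beta> * s powr (-\<beta>)"
    if "length xs \<le> 2" "\<beta> = 1 + \<delta> - real (length xs)" "0 < \<beta>" for xs \<beta> x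
  proof -
    have "((\<lambda>s. A / \<beta> * s powr (-\<beta>)) \<longlongrightarrow> A / \<beta> * 0) at_top"
      using that(3) by (intro tendsto_mult tendsto_const tendsto_neg_powr filterlim_ident) auto
    moreover have "\<bar>U xs t x - U xs s x\<bar> \<le> A / \<beta> * s powr (-\<beta>)" if "0 < s" "s \<le> t" for s t
    proof -
      have "\<bar>U xs t x - U xs s x\<bar> \<le> A * (t powr (-\<beta>) - s powr (-\<beta>)) / (-\<beta>)"
        using that \<open>length xs \<le> 2\<close> \<open>\<beta> = _\<close> by (intro U) auto
      also have "\<dots> = A / \<beta> * s powr (-\<beta>) - A / \<beta> * t powr (-\<beta>)"
        by (simp add: right_diff_distrib diff_divide_distrib)
      also have "\<dots> \<le> A / \<beta> * s powr (-\<beta>)"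
        using A0 \<open>0 < \<beta>\<close> by simp
      finally show ?thesis .
    qed
    ultimately obtain g where "\<And>s. 0 < s \<Longrightarrow> \<bar>U xs s x - g\<bar> \<le> A / \<beta> * s powr (-\<beta>)"
      using limit_at_top_if_increments_bounded[of "\<lambda>s. U xs s x" "\<lambda>s. A / \<beta> * s powr (-\<beta>)"] by auto
    then show ?thesis by blast
  qed
  have "\<forall>x. \<exists>g. \<forall>s>0. \<bar>U [] s x - g\<bar> \<le> A / (1 + \<delta>) * s powr (-(1 + \<delta>))"
    using \<delta> by (intro allI lim) auto
  then obtain g where g: "\<And>s x. 0 < s \<Longrightarrow> \<bar>U [] s x - g x\<bar> \<le> A / (1 + \<delta>) * s powr (-(1 + \<delta>))"
    by metis
  have "\<forall>i x. \<exists>g. \<forall>s>0. \<bar>U [i] s x - g\<bar> \<le> A / \<delta> * s powr (-\<delta>)"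
    using \<delta> by (intro allI lim) auto
  then obtain G where G: "\<And>s i x. 0 < s \<Longrightarrow> \<bar>U [i] s x - G i x\<bar> \<le> A / \<delta> * s powr (-\<delta>)"
    by metis
  have powr0: "(\<lambda>n. B * real (Suc n) powr (-\<beta>)) \<longlonglongrightarrow> 0" if "0 < \<beta>" for B \<beta>
  proof -
    have "(\<lambda>n. B * real (Suc n) powr (-\<beta>)) \<longlonglongrightarrow> B * 0"
      using that by (intro tendsto_mult tendsto_const tendsto_neg_powr
          filterlim_compose[OF filterlim_real_sequentially filterlim_Suc]) auto
    then show ?thesis by simp
  qed
  have glim: "(\<lambda>n. U [] (real (Suc n)) x) \<longlonglongrightarrow> g x" for x
  proof (rule LIM_zero_cancel, rule Lim_null_comparison)
    show "(\<lambda>n. A / (1 + \<delta>) * real (Suc n) powr (-(1 + \<delta>))) \<longlonglongrightarrow> 0"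
      using \<delta> by (intro powr0) auto
    show "\<forall>\<^sub>F n in sequentially. norm (U [] (real (Suc n)) x - g x) \<le> A / (1 + \<delta>) * real (Suc n) powr (-(1 + \<delta>))"
      using g by (intro always_eventually) simp
  qed
  \<comment> \<open>The rate for \<open>U [i]\<close> does not depend on \<open>x\<close>; uniform
    convergence of the derivatives lets them pass to the limit.\<close>
  have "\<exists>g'. \<forall>x\<in>UNIV. (\<lambda>n. U [] (real (Suc n)) x) \<longlonglongrightarrow> g' x \<and>
      (g' has_derivative (\<lambda>h. \<Sum>i\<in>UNIV. h $ i * G i x)) (at x within UNIV)"
  proof (rule has_derivative_sequence[OF convex_UNIV _ _ UNIV_I glim])
    show "((\<lambda>x. U [] (real (Suc n)) x) has_derivative (\<lambda>h. \<Sum>i\<in>UNIV. h $ i * U [i] (real (Suc n)) x)) (at x within UNIV)" for n x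
      by (rule dU) simp
    fix e :: real assume "0 < e"
    have "(\<lambda>n. (real CARD('n) * A / \<delta>) * real (Suc n) powr (-\<delta>)) \<longlonglongrightarrow> 0"
      using \<delta> by (intro powr0) auto
    then have "\<forall>\<^sub>F n in sequentially. (real CARD('n) * A / \<delta>) * real (Suc n) powr (-\<delta>) < e"
      using \<open>0 < e\<close> by (rule order_tendstoD)
    then show "\<forall>\<^sub>F n in sequentially. \<forall>x\<in>UNIV. \<forall>h. norm ((\<Sum>i\<in>UNIV. h $ i * U [i] (real (Suc n)) x) - (\<Sum>i\<in>UNIV. h $ i * G i x)) \<le> e * norm h"
    proof eventually_elim
      case (elim n)
      show ?case
      proof (intro ballI allI)
        fix x h :: "real^'n"
        have "\<bar>(\<Sum>i\<in>UNIV. h $ i * U [i] (real (Suc n)) x) - (\<Sum>i\<in>UNIV. h $ i * G i x)\<bar>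
           = \<bar>\<Sum>i\<in>UNIV. h $ i * (U [i] (real (Suc n)) x - G i x)\<bar>"
          by (simp add: sum_subtractf right_diff_distrib)
        also have "\<dots> \<le> (\<Sum>i\<in>(UNIV::'n set). norm h * (A / \<delta> * real (Suc n) powr (-\<delta>)))"
          using G[of "real (Suc n)"]
          by (intro order.trans[OF sum_abs] sum_mono) (simp only: abs_mult, intro mult_mono component_le_norm_cart, auto)
        also have "\<dots> = ((real CARD('n) * A / \<delta>) * real (Suc n) powr (-\<delta>)) * norm h"
          by simp
        also have "\<dots> \<le> e * norm h"
          using elim by (intro mult_right_mono) auto
        finally show "norm ((\<Sum>i\<in>UNIV. h $ i * U [i] (real (Suc n)) x) - (\<Sum>i\<in>UNIV. h $ i * G i x)) \<le> e * norm h"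
          by simp
      qed
    qed
  qed
  then obtain g' where g': "\<And>x. (\<lambda>n. U [] (real (Suc n)) x) \<longlonglongrightarrow> g' x"
    "\<And>x. (g' has_derivative (\<lambda>h. \<Sum>i\<in>UNIV. h $ i * G i x)) (at x)"
    by auto
  have "g' = g"
    using LIMSEQ_unique[OF g'(1) glim] by auto
  \<comment> \<open>The increment bound is started at a scale \<open>s\<close> tending to 0. There
    \<open>U\<close> is at most \<open>B * s ^ 3\<close>, so the constant \<open>B\<close>, which
    contains the bound \<open>W\<close> of \<open>u\<close>, disappears.\<close>
  have U3: "\<bar>U [m, l] t x\<bar> \<le> A / (1 - \<delta>) * t powr (1 - \<delta>)" if t: "0 < t" for m l t x
  proof -
    obtain M' where M': "\<And>z. \<bar>partial j (higher_partial [m, l] (K b)) z\<bar> \<le> M'"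
      using test_fun_bounded[OF test(1)[of "j # [m, l]"]] by auto
    define B where "B = W * M' * (measure lborel (ball (0 :: real^'n) 1) * r ^ CARD('n))"
    have "\<bar>U [m, l] t x\<bar> \<le> A / (1 - \<delta>) * t powr (1 - \<delta>) + B * s ^ 3" if s: "0 < s" "s \<le> t" for s
    proof -
      have "\<bar>U [m, l] t x - U [m, l] s x\<bar> \<le> A * (t powr (1 - \<delta>) - s powr (1 - \<delta>)) / (1 - \<delta>)"
        using s \<delta> by (intro U) auto
      also have "\<dots> \<le> A * t powr (1 - \<delta>) / (1 - \<delta>)"
        using A0 \<delta> by (intro divide_right_mono mult_left_mono) auto
      finally have 1: "\<bar>U [m, l] t x - U [m, l] s x\<bar> \<le> A / (1 - \<delta>) * t powr (1 - \<delta>)"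
        by simp
      have "\<bar>mconv u (partial j (higher_partial [m, l] (K b))) s x\<bar> \<le> B / s ^ CARD('n)"
        unfolding B_def using test(1)[of "j # [m, l]"] zero(1)[where xs = "j # [m, l]"] M' s
        by (intro mconv_bound[OF u _ _ _ r(1)]) auto
      then have "\<bar>U [m, l] s x\<bar> \<le> s ^ (CARD('n) + 3) * (B / s ^ CARD('n))"
        unfolding U_def abs_mult using s by (intro mult_mono) (auto simp: numeral_3_eq_3)
      also have "\<dots> = B * s ^ 3"
        using s by (simp add: power_add)
      finally show ?thesis using 1 by linarith
    qed
    then have "\<forall>\<^sub>F s in at_right 0. \<bar>U [m, l] t x\<bar> \<le> A / (1 - \<delta>) * t powr (1 - \<delta>) + B * s ^ 3"
      using t by (auto simp: eventually_at_right intro!: exI[of _ t])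
    moreover have "((\<lambda>s. A / (1 - \<delta>) * t powr (1 - \<delta>) + B * s ^ 3) \<longlongrightarrow> A / (1 - \<delta>) * t powr (1 - \<delta>) + B * 0 ^ 3) (at_right 0)"
      by (intro tendsto_intros)
    ultimately show ?thesis
      using tendsto_lowerbound[of _ _ "at_right (0::real)" "\<bar>U [m, l] t x\<bar>"] by auto
  qed
  have "\<bar>G i x - G i y\<bar> \<le> (2 / \<delta> + real CARD('n) / (1 - \<delta>)) * A * norm (x - y) powr \<delta>" for i x y
  proof (cases "x = y")
    case False
    \<comment> \<open>At this scale the approximation error \<open>s powr (-\<delta>)\<close> and
      the mean value term \<open>s powr (1 - \<delta>) * norm (x - y)\<close> both equal
      \<open>norm (x - y) powr \<delta>\<close>. The approximation is used at both points, whence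
      \<open>2 / \<delta>\<close>.\<close>
    define s where "s = 1 / norm (x - y)"
    have s: "0 < s" using False by (simp add: s_def)
    have "\<bar>U [i] s x - U [i] s y\<bar> \<le> real CARD('n) * (A / (1 - \<delta>) * s powr (1 - \<delta>)) * norm (x - y)"
      by (rule has_derivative_norm_bound[OF dU[OF s] U3[OF s]])
    moreover have "s powr (1 - \<delta>) * norm (x - y) = norm (x - y) powr \<delta>"
      using False by (simp add: s_def powr_divide powr_diff)
    ultimately have 1: "\<bar>U [i] s x - U [i] s y\<bar> \<le> real CARD('n) / (1 - \<delta>) * A * norm (x - y) powr \<delta>"
      by (simp add: mult.assoc)
    have "s powr (-\<delta>) = norm (x - y) powr \<delta>"
      using False by (simp add: s_def powr_divide powr_minus_divide)
    then have 2: "\<bar>U [i] s z - G i z\<bar> \<le> A / \<delta> * norm (x - y) powr \<delta>" for z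
      using G[OF s, of i z] by simp
    have "\<bar>G i x - G i y\<bar> \<le> 2 * (A / \<delta> * norm (x - y) powr \<delta>) + real CARD('n) / (1 - \<delta>) * A * norm (x - y) powr \<delta>"
      using 1 2[of x] 2[of y] by linarith
    then show ?thesis by (simp add: algebra_simps)
  qed auto
  moreover have "- (1 + \<delta>) = - 1 - \<delta>" by simp
  ultimately show thesis
    using that[of g G] g g'(2) \<open>g' = g\<close> by (simp add: U_def)
qed

section \<open>The kernels and the final estimate\<close>

lemma smooth_family_bounded_on_compact:
  fixes G :: "'p::topological_space \<Rightarrow> real^'n::finite \<Rightarrow> real"
  assumes "smooth_family G" "compact P" "compact Z"
  obtains M where "\<And>p z. p \<in> P \<Longrightarrow> z \<in> Z \<Longrightarrow> \<bar>G p z\<bar> \<le> M"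
proof -
  have "compact ((\<lambda>(p, z). G p z) ` (P \<times> Z))"
    by (intro compact_continuous_image compact_Times assms continuous_on_subset[OF smooth_family_continuous]) auto
  then obtain M where "\<And>y. y \<in> (\<lambda>(p, z). G p z) ` (P \<times> Z) \<Longrightarrow> \<bar>y\<bar> \<le> M"
    using compact_imp_bounded bounded_iff by (metis real_norm_def)
  then show thesis by (intro that[of M]) force
qed

definition quad :: "real^'n^'n \<Rightarrow> real^'n::finite \<Rightarrow> real" where
  "quad b z = (\<Sum>i\<in>UNIV. \<Sum>j\<in>UNIV. b $ i $ j * z $ i * z $ j)"

lemma quad_inner: "quad b z = z \<bullet> (b *v z)"
  by (simp add: quad_def inner_vec_def matrix_vector_mult_def sum_distrib_left mult_ac)

text \<open>\<open>bump 0\<close> and \<open>bump 2\<close> are the \<psi> and \<eta> of the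
  overview.\<close>

definition bump :: "nat \<Rightarrow> real^'n^'n \<Rightarrow> real^'n::finite \<Rightarrow> real" where
  "bump n b z = flat n (1 - 1 / 2 * quad b z)"

lemma smooth_family_level: "smooth_family (\<lambda>b z. 1 - 1 / 2 * quad b z)"
  unfolding quad_def
  by (intro smooth_family_diff smooth_family.mult smooth_family_real smooth_family_sum smooth_family.coord smooth_family.const continuous_intros)

lemma smooth_family_bump: "smooth_family (bump n)"
  using smooth_family.flat[OF smooth_family_level] by (simp add: bump_def[abs_def])

lemma symmetric_inner:
  fixes b :: "real^'n::finite^'n"
  assumes "transpose b = b"
  shows "x \<bullet> (b *v y) = (b *v x) \<bullet> y"
  using dot_lmul_matrix[of x b y] by (metis assms transpose_matrix_vector)

lemma partial_level:
  fixes b :: "real^'n::finite^'n"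
  assumes "transpose b = b"
  shows "partial l (\<lambda>z. 1 - 1 / 2 * quad b z) z = - (b *v z) $ l"
proof -
  have "((\<lambda>z. b *v z) has_derivative (\<lambda>h. b *v h)) (at z)"
    by (rule bounded_linear_imp_has_derivative) simp
  then have "((\<lambda>z. 1 - 1 / 2 * quad b z) has_derivative (\<lambda>h. - (1 / 2 * (z \<bullet> (b *v h) + h \<bullet> (b *v z))))) (at z)"
    unfolding quad_inner by (auto intro!: derivative_eq_intros)
  then have "partial l (\<lambda>z. 1 - 1 / 2 * quad b z) z = - (1 / 2 * (z \<bullet> (b *v axis l 1) + axis l 1 \<bullet> (b *v z)))"
    by (rule partial_has_derivative)
  also have "\<dots> = - (b *v z) $ l"
    unfolding symmetric_inner[OF assms, of z] by (simp add: inner_axis inner_axis')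
  finally show ?thesis .
qed

lemma partial_matrix_vector: "partial l (\<lambda>z. (b *v z) $ i) z = (b :: real^'n::finite^'n) $ i $ l"
proof -
  have "((\<lambda>z. (b *v z) $ i) has_derivative (\<lambda>h. (b *v h) $ i)) (at z)"
    by (intro bounded_linear_imp_has_derivative bounded_linear_compose[OF bounded_linear_vec_nth]) simp
  then show ?thesis
    by (simp add: partial_has_derivative matrix_vector_mult_basis column_def)
qed

lemma partial_bump:
  fixes b :: "real^'n::finite^'n"
  assumes "transpose b = b"
  shows "partial l (bump n b) z = - (bump (n + 2) b z - real n * bump (n + 1) b z) * (b *v z) $ l"
  unfolding bump_def
  unfolding partial_flat[OF smooth_family_imp_differentiable[OF smooth_family_level]] partial_level[OF assms] by (simp add: algebra_simps)

text \<open>In the second derivatives of \<psi> the quadratic term in \<open>b *v z\<close>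
  contracts with \<open>a\<close> to the radial derivative of \<eta>, because \<open>a\<close> sends
  \<open>b *v z\<close> back to \<open>z\<close>. The remaining term contracts to the trace of the
  identity, that is, to the dimension.\<close>

lemma scaling_pair_bump:
  fixes a :: "'n::finite \<Rightarrow> 'n \<Rightarrow> real"
  assumes sym: "transpose b = b" and inv: "(\<chi> i j. a i j) ** b = mat 1"
  shows "scaling_pair a 0 (bump 2 b) (bump 0 b)"
  unfolding scaling_pair_def
proof
  fix z :: "real^'n"
  define A where "A = (\<chi> i j. a i j)"
  define p where "p = b *v z"
  define D where "D = bump 4 b z - 2 * bump 3 b z"
  have d: "(\<lambda>z. (b *v z) $ i) differentiable (at z)" for i z
    by (intro bounded_linear_imp_differentiable bounded_linear_compose[OF bounded_linear_vec_nth]) simp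
  have p1: "partial j (bump 0 b) = (\<lambda>z. (-1) * (bump 2 b z * (b *v z) $ j))" for j
    using partial_bump[OF sym, of j 0] by (auto simp: numeral_2_eq_2)
  have p2: "partial l (bump 2 b) z = - D * p $ l" for l
    using partial_bump[OF sym, of l 2 z] by (simp add: D_def p_def)
  have p3: "partial i (partial j (bump 0 b)) z = D * (p $ i * p $ j) - bump 2 b z * b $ j $ i" for i j
  proof -
    have "(\<lambda>z. bump 2 b z * (b *v z) $ j) differentiable (at z)"
      by (intro differentiable_mult d smooth_family_imp_differentiable[OF smooth_family_bump])
    then have "partial i (partial j (bump 0 b)) z = (-1) * partial i (\<lambda>z. bump 2 b z * (b *v z) $ j) z"
      unfolding p1 by (rule partial_cmult)
    then show ?thesis
      by (simp add: partial_mult[OF smooth_family_imp_differentiable[OF smooth_family_bump] d] partial_matrix_vector p2 p_def[symmetric])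
  qed
  have ap: "(\<Sum>j\<in>UNIV. a i j * p $ j) = z $ i" for i
  proof -
    have "A *v (b *v z) = z"
      using inv by (simp add: matrix_vector_mul_assoc A_def)
    then have "(A *v p) $ i = z $ i" by (simp add: p_def)
    then show ?thesis by (simp add: A_def matrix_vector_mult_def)
  qed
  have ab: "(\<Sum>j\<in>UNIV. a i j * b $ j $ i) = 1" for i
  proof -
    have "(A ** b) $ i $ i = 1"
      using inv by (simp add: A_def mat_def)
    then show ?thesis by (simp add: A_def matrix_matrix_mult_def)
  qed
  have "elliptic a (bump 0 b) z = (\<Sum>i\<in>UNIV. D * p $ i * (\<Sum>j\<in>UNIV. a i j * p $ j) - bump 2 b z * (\<Sum>j\<in>UNIV. a i j * b $ j $ i))"
    unfolding elliptic_def p3 by (simp add: right_diff_distrib sum_subtractf sum_distrib_left mult_ac)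
  also have "\<dots> = D * (\<Sum>i\<in>UNIV. z $ i * p $ i) - real CARD('n) * bump 2 b z"
    unfolding ap ab by (simp add: sum_subtractf sum_distrib_left mult_ac)
  finally show "real (CARD('n) + 0) * bump 2 b z + (\<Sum>i\<in>UNIV. z $ i * partial i (bump 2 b) z) = - elliptic a (bump 0 b) z"
    unfolding p2 by (simp add: sum_distrib_left sum_negf mult_ac)
qed

section \<open>Bounds uniform over the admissible matrices\<close>

text \<open>The bounds are obtained without diagonalisation, from the two quadratic inequalities for
  \<open>A\<close> alone. The bound on \<open>norm b\<close> places \<open>b\<close> in a compact
  ball that depends only on d and \<nu>.\<close>

lemma elliptic_inverse:
  fixes A :: "real^'n::finite^'n"
  assumes sym: "transpose A = A" and \<nu>: "0 < \<nu>"
    and low: "\<And>\<xi>. \<nu> * (norm \<xi>)\<^sup>2 \<le> quad A \<xi>" and up: "\<And>\<xi>. quad A \<xi> \<le> (norm \<xi>)\<^sup>2 / \<nu>"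
  obtains b where "transpose b = b" "A ** b = mat 1" "\<And>z. \<nu> * (norm z)\<^sup>2 \<le> quad b z" "\<And>z. quad b z \<le> (norm z)\<^sup>2 / \<nu>"
    "norm b \<le> (real CARD('n))\<^sup>2 / \<nu>"
proof -
  have "x = 0" if "A *v x = 0" for x
    using low[of x] \<nu> that by (simp add: quad_inner mult_le_0_iff)
  then obtain b where "b ** A = mat 1"
    using matrix_left_invertible_ker[of A] by blast
  then have Ab: "A ** b = mat 1"
    using matrix_left_right_inverse by blast
  have "transpose b ** A = mat 1"
    using arg_cong[OF Ab, of transpose] by (simp add: matrix_transpose_mul sym transpose_mat)
  then have sb: "transpose b = b"
    by (metis Ab matrix_mul_assoc matrix_mul_lid matrix_mul_rid)
  have z: "A *v (b *v z) = z" for z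
    by (simp add: matrix_vector_mul_assoc Ab)
  have qb: "quad b z = quad A (b *v z)" for z
    by (simp add: quad_inner z inner_commute)
  have wz: "norm (b *v z) \<le> norm z / \<nu>" for z
  proof (cases "b *v z = 0")
    case False
    have "\<nu> * (norm (b *v z))\<^sup>2 \<le> norm (b *v z) * norm z"
      using low[of "b *v z"] norm_cauchy_schwarz[of "b *v z" z] by (simp add: quad_inner z)
    then have "\<nu> * norm (b *v z) \<le> norm z"
      using False by (simp add: power2_eq_square mult.left_commute)
    then show ?thesis using \<nu> by (simp add: field_simps)
  qed (use \<nu> in auto)
  show thesis
  proof (rule that[OF sb Ab])
    fix z
    \<comment> \<open>Completing the square: the left-hand side is nonnegative and the last term is
      at most \<open>\<nu> * (norm z)\<^sup>2\<close>, which leaves the lower bound for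
      \<open>quad b z\<close>.\<close>
    have "quad A (b *v z - \<nu> *\<^sub>R z) = quad A (b *v z) - 2 * \<nu> * (norm z)\<^sup>2 + \<nu>\<^sup>2 * quad A z"
      using symmetric_inner[OF sym, of "b *v z" z] unfolding power2_norm_eq_inner
      by (simp add: quad_inner matrix_vector_mult_diff_distrib matrix_vector_mult_scaleR z inner_diff_left inner_diff_right
          power2_eq_square inner_commute algebra_simps)
    moreover have "0 \<le> quad A (b *v z - \<nu> *\<^sub>R z)"
      using low[of "b *v z - \<nu> *\<^sub>R z"] \<nu> by (auto intro: order.trans[rotated])
    moreover have "\<nu>\<^sup>2 * quad A z \<le> \<nu> * (norm z)\<^sup>2"
      using mult_left_mono[OF up[of z], of "\<nu>\<^sup>2"] \<nu> by (simp add: power2_eq_square)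
    ultimately show "\<nu> * (norm z)\<^sup>2 \<le> quad b z"
      unfolding qb by simp
    have "quad b z \<le> norm z * norm (b *v z)"
      unfolding quad_inner by (rule norm_cauchy_schwarz)
    also have "\<dots> \<le> norm z * (norm z / \<nu>)"
      using wz by (intro mult_left_mono) auto
    finally show "quad b z \<le> (norm z)\<^sup>2 / \<nu>"
      by (simp add: power2_eq_square)
  next
    have e: "\<bar>b $ i $ j\<bar> \<le> 1 / \<nu>" for i j
    proof -
      have "\<bar>(b *v axis j 1) $ i\<bar> \<le> 1 / \<nu>"
        using order.trans[OF component_le_norm_cart wz, of "axis j 1" i] by simp
      then show ?thesis by (simp add: matrix_vector_mult_basis column_def)
    qed
    have "norm b \<le> (\<Sum>i\<in>UNIV. norm (b $ i))"
      unfolding norm_vec_def[of b] by (rule L2_set_le_sum) simp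
    also have "\<dots> \<le> (\<Sum>i\<in>UNIV. \<Sum>j\<in>UNIV. \<bar>b $ i $ j\<bar>)"
      by (intro sum_mono norm_le_l1_cart)
    also have "\<dots> \<le> (\<Sum>i\<in>(UNIV::'n set). \<Sum>j\<in>(UNIV::'n set). 1 / \<nu>)"
      by (intro sum_mono e)
    finally show "norm b \<le> (real CARD('n))\<^sup>2 / \<nu>"
      by (simp add: power2_eq_square)
  qed
qed

lemma bump_zero_outside:
  assumes "0 < \<nu>" "\<nu> * (norm z)\<^sup>2 \<le> quad b z" "sqrt (2 / \<nu>) < norm z"
  shows "bump n b z = 0"
proof -
  have "2 / \<nu> < (norm z)\<^sup>2"
    using assms(3) by (rule real_sqrt_less_iff[THEN iffD1, OF order.strict_trans2]) simp
  then have "2 < \<nu> * (norm z)\<^sup>2"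
    using assms(1) by (simp add: field_simps)
  then show ?thesis
    using assms(2) by (simp add: bump_def)
qed

text \<open>The limit must be divided by this mass, which varies with \<open>b\<close>, while the
  final constant may not. On the ball of radius \<open>sqrt \<nu>\<close> the argument of
  \<open>flat 2\<close> lies between 1/2 and 1, so its value is at least exp (-2).\<close>

lemma bump_integral_lower_bound:
  fixes b :: "real^'n::finite^'n"
  assumes \<nu>: "0 < \<nu>" and low: "\<And>z. \<nu> * (norm z)\<^sup>2 \<le> quad b z" and up: "\<And>z. quad b z \<le> (norm z)\<^sup>2 / \<nu>"
  shows "exp (- 2) * measure lborel (cball (0 :: real^'n) (sqrt \<nu>)) \<le> (LINT z|lebesgue. bump 2 b z)"
proof -
  have "exp (- 2) * measure lborel (cball (0 :: real^'n) (sqrt \<nu>)) = (LINT z|lebesgue. exp (- 2) * indicator (cball 0 (sqrt \<nu>)) (z :: real^'n))"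
    by simp
  also have "\<dots> \<le> (LINT z|lebesgue. bump 2 b z)"
  proof (rule integral_mono)
    show "integrable lebesgue (\<lambda>z. exp (- 2) * indicator (cball 0 (sqrt \<nu>)) (z :: real^'n) :: real)"
      using emeasure_lborel_cball_finite[of "0 :: real^'n" "sqrt \<nu>"]
      by (intro integrable_mult_right integrable_real_indicator) auto
    show "integrable lebesgue (bump 2 b)"
      using bump_zero_outside[OF \<nu> low]
      by (intro test_fun_integrable test_funI[of _ "sqrt (2 / \<nu>)"] smooth_family_smooth[OF smooth_family_bump])
    fix z :: "real^'n"
    show "exp (- 2) * indicator (cball 0 (sqrt \<nu>)) z \<le> bump 2 b z"
    proof (cases "norm z \<le> sqrt \<nu>")
      case True
      then have "(norm z)\<^sup>2 \<le> (sqrt \<nu>)\<^sup>2"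
        by (intro power_mono) auto
      then have "quad b z \<le> 1"
        using up[of z] \<nu> by (intro order.trans[OF up]) (simp add: field_simps)
      moreover have "0 \<le> quad b z"
        using low[of z] \<nu> by (auto intro: order.trans[rotated])
      moreover define t where "t = 1 - 1 / 2 * quad b z"
      ultimately have t: "1 / 2 \<le> t" "t \<le> 1" by auto
      then have "exp (- 2) \<le> exp (- (1 / t))"
        by (simp add: field_simps)
      also have "\<dots> \<le> exp (- (1 / t)) / t\<^sup>2"
        using t by (simp add: le_divide_eq power_le_one)
      finally show ?thesis
        unfolding bump_def t_def[symmetric] using True t by (simp add: flat_def)
    qed (simp add: bump_def)
  qed
  finally show ?thesis .
qed

lemma higher_partial_bump_bounded:
  assumes \<nu>: "0 < \<nu>"
  obtains M where "0 \<le> M" "\<And>xs z (b :: real^'n::finite^'n). length xs \<le> m \<Longrightarrow> norm b \<le> R \<Longrightarrow>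
    (\<And>z. \<nu> * (norm z)\<^sup>2 \<le> quad b z) \<Longrightarrow> \<bar>higher_partial xs (bump n b) z\<bar> \<le> M"
proof -
  let ?I = "{xs :: 'n list. length xs \<le> m}"
  \<comment> \<open>Compactness is applied to a full ball of matrices and a fixed ball of points.
    Ellipticity enters only afterwards, to make the kernel vanish at all other points.\<close>
  have "\<forall>xs :: 'n list. \<exists>M. \<forall>b\<in>cball (0 :: real^'n^'n) R. \<forall>z\<in>cball 0 (sqrt (2 / \<nu>)). \<bar>higher_partial xs (bump n b) z\<bar> \<le> M"
    by (metis smooth_family_bounded_on_compact[OF smooth_family_higher_partial[OF smooth_family_bump] compact_cball compact_cball])
  then obtain B where B: "\<And>xs b z. norm (b :: real^'n^'n) \<le> R \<Longrightarrow> norm z \<le> sqrt (2 / \<nu>) \<Longrightarrow> \<bar>higher_partial xs (bump n b) z\<bar> \<le> B xs"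
    by (auto simp: Ball_def) metis
  have fin: "finite ?I"
    using finite_lists_length_le[of "UNIV :: 'n set" m] by simp
  define M where "M = (\<Sum>xs\<in>?I. \<bar>B xs\<bar>)"
  show thesis
  proof (rule that[of M])
    show "0 \<le> M" by (simp add: M_def sum_nonneg)
    fix xs :: "'n list" and z :: "real^'n" and b :: "real^'n^'n"
    assume xs: "length xs \<le> m" and b: "norm b \<le> R" and low: "\<And>z. \<nu> * (norm z)\<^sup>2 \<le> quad b z"
    show "\<bar>higher_partial xs (bump n b) z\<bar> \<le> M"
    proof (cases "norm z \<le> sqrt (2 / \<nu>)")
      case True
      have "\<bar>higher_partial xs (bump n b) z\<bar> \<le> \<bar>B xs\<bar>"
        using B[OF b True, of xs] by simp
      also have "\<dots> \<le> M"
        unfolding M_def using fin xs by (intro member_le_sum) auto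
      finally show ?thesis .
    next
      case False
      then have "higher_partial xs (bump n b) z = 0"
        using bump_zero_outside[OF \<nu> low] by (intro higher_partial_zero_outside) auto
      then show ?thesis by (simp add: M_def sum_nonneg)
    qed
  qed
qed

text \<open>The real \<open>Sup\<close> in \<open>holder_x'\<close> bounds its quotients only
  because \<open>holder_x'_finite\<close> makes the set of quotients bounded above.\<close>

lemma holder_x'_bound:
  assumes "holder_x'_finite Q \<delta> f" "j \<in> Q" "0 < t"
  shows "\<bar>f (t *\<^sub>R axis j 1 + y) - f y\<bar> \<le> holder_x' Q \<delta> f * t powr \<delta>"
proof -
  let ?S = "{\<bar>f x - f y\<bar> / norm (x - y) powr \<delta> | x y. x \<noteq> y \<and> (\<forall>i. i \<notin> Q \<longrightarrow> x $ i = y $ i)}"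
  obtain C where C: "\<And>x y. (\<forall>i. i \<notin> Q \<longrightarrow> x $ i = y $ i) \<Longrightarrow> \<bar>f x - f y\<bar> \<le> C * norm (x - y) powr \<delta>"
    using assms(1) by (auto simp: holder_x'_finite_def)
  have "bdd_above ?S"
    using C by (intro bdd_aboveI[of _ C]) (auto simp: divide_le_eq)
  moreover define x where "x = t *\<^sub>R axis j 1 + y"
  have x: "norm (x - y) = t"
    using assms(3) by (simp add: x_def)
  then have "x \<noteq> y" using assms(3) by auto
  moreover have "\<forall>i. i \<notin> Q \<longrightarrow> x $ i = y $ i"
    using assms(2) by (auto simp: x_def axis_def)
  ultimately have "\<bar>f x - f y\<bar> / norm (x - y) powr \<delta> \<le> holder_x' Q \<delta> f"
    unfolding holder_x'_def by (intro cSup_upper) auto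
  then show ?thesis
    using assms(3) unfolding x by (simp add: x_def divide_le_eq)
qed

text \<open>Weak derivatives are equivalence classes, here carried by the witnesses
  \<open>g1\<close> and \<open>g2\<close>. Regularity of D_j u therefore means that some
  continuously differentiable \<open>v\<close> agrees with \<open>g1 j\<close> almost
  everywhere.\<close>

theorem theorem5p1:
  fixes q :: nat and \<delta> \<nu> :: real
  assumes "CARD('n::finite) \<ge> 2"
    and "1 \<le> q" and "q < CARD('n)"
    and "0 < \<delta>" and "\<delta> < 1"
    and "0 < \<nu>" and "\<nu> \<le> 1"
  shows "\<exists>N::real. \<forall>(Q::'n set) (a::'n \<Rightarrow> 'n \<Rightarrow> real) (f::real^'n \<Rightarrow> real) u g1 g2.
     card Q = q \<and>
     (\<forall>i j. a i j = a j i) \<and>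
     (\<forall>\<xi>::real^'n. \<nu> * norm \<xi> ^ 2 \<le> (\<Sum>i\<in>UNIV. \<Sum>j\<in>UNIV. a i j * \<xi>$i * \<xi>$j) \<and>
                  (\<Sum>i\<in>UNIV. \<Sum>j\<in>UNIV. a i j * \<xi>$i * \<xi>$j) \<le> norm \<xi> ^ 2 / \<nu>) \<and>
     C_delta_x' Q \<delta> f \<and>
     bounded (range u) \<and> W22_loc_with u g1 g2 \<and>
     (AE x in lebesgue. (\<Sum>i\<in>UNIV. \<Sum>j\<in>UNIV. a i j * g2 i j x) = f x)
     \<longrightarrow>
     (\<forall>j\<in>Q. \<exists>v. (AE x in lebesgue. v x = g1 j x) \<and>
        (\<forall>x. v differentiable (at x)) \<and>
        (\<forall>i. continuous_on UNIV (partial i v)) \<and>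
        (\<forall>i x y. \<bar>partial i v x - partial i v y\<bar> \<le> N * holder_x' Q \<delta> f * norm (x - y) powr \<delta>))"
proof -
  note \<delta> = \<open>0 < \<delta>\<close> \<open>\<delta> < 1\<close> and \<nu> = \<open>0 < \<nu>\<close>
  let ?d = "real CARD('n)"
  define r where "r = sqrt (2 / \<nu>)"
  define c0 where "c0 = exp (- 2) * measure lborel (cball (0 :: real^'n) (sqrt \<nu>))"
  have r: "0 \<le> r" using \<nu> by (simp add: r_def)
  have c0: "0 < c0" using \<nu> content_cball_pos[of "sqrt \<nu>" "0 :: real^'n"] by (simp add: c0_def)
  obtain M where M: "0 \<le> M" "\<And>xs z (b :: real^'n^'n). length xs \<le> 3 \<Longrightarrow> norm b \<le> ?d\<^sup>2 / \<nu> \<Longrightarrow>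
      (\<And>z. \<nu> * (norm z)\<^sup>2 \<le> quad b z) \<Longrightarrow> \<bar>higher_partial xs (bump 0 b) z\<bar> \<le> M"
    using higher_partial_bump_bounded[OF \<nu>, of 3 "?d\<^sup>2 / \<nu>" 0] by metis
  define A where "A = 2 * M * (measure lborel (ball (0 :: real^'n) 1) * r ^ CARD('n))"
  \<comment> \<open>The constant of the core estimate with the semi-norm of \<open>f\<close> taken
    out, divided by the lower bound for the mass. All ingredients are fixed before \<open>Q\<close>,
    \<open>a\<close>, \<open>f\<close> and \<open>u\<close>.\<close>
  define N where "N = (2 / \<delta> + ?d / (1 - \<delta>)) * A / c0"
  have A: "0 \<le> A" using M(1) r by (simp add: A_def)
  have "\<exists>v. (AE x in lebesgue. v x = g1 j x) \<and> (\<forall>x. v differentiable (at x)) \<and>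
        (\<forall>i. continuous_on UNIV (partial i v)) \<and>
        (\<forall>i x y. \<bar>partial i v x - partial i v y\<bar> \<le> N * holder_x' Q \<delta> f * norm (x - y) powr \<delta>)"
    if asym: "\<And>i j. a i j = a j i"
      and aell: "\<And>\<xi>::real^'n. \<nu> * norm \<xi> ^ 2 \<le> (\<Sum>i\<in>UNIV. \<Sum>j\<in>UNIV. a i j * \<xi>$i * \<xi>$j)"
        "\<And>\<xi>::real^'n. (\<Sum>i\<in>UNIV. \<Sum>j\<in>UNIV. a i j * \<xi>$i * \<xi>$j) \<le> norm \<xi> ^ 2 / \<nu>"
      and f: "C_delta_x' Q \<delta> f" and ub: "bounded (range u)" and W: "W22_loc_with u g1 g2"
      and eq: "AE x in lebesgue. (\<Sum>i\<in>UNIV. \<Sum>j\<in>UNIV. a i j * g2 i j x) = f x"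
      and j: "j \<in> Q"
    for Q :: "'n set" and a and f u :: "real^'n \<Rightarrow> real" and g1 g2 j
  proof -
    define H where "H = holder_x' Q \<delta> f"
    have hoelder: "\<bar>f (t *\<^sub>R axis j 1 + y) - f y\<bar> \<le> H * t powr \<delta>" if "0 < t" for t y
      unfolding H_def using f j that by (intro holder_x'_bound) (auto simp: C_delta_x'_def)
    have H: "0 \<le> H"
      using order.trans[OF abs_ge_zero hoelder[of 1 0]] by simp
    obtain b where b: "transpose b = b" "(\<chi> i j. a i j) ** b = mat 1" "\<And>z. \<nu> * (norm z)\<^sup>2 \<le> quad b z"
      "\<And>z. quad b z \<le> (norm z)\<^sup>2 / \<nu>" "norm b \<le> ?d\<^sup>2 / \<nu>"
      by (rule elliptic_inverse[of "\<chi> i j. a i j", OF _ \<nu>])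
        (use asym aell in \<open>auto simp: quad_def transpose_def\<close>)
    obtain F where F: "\<And>y. \<bar>f y\<bar> \<le> F"
      using f by (auto simp: C_delta_x'_def bounded_iff)
    have fm: "f \<in> borel_measurable lebesgue"
      using f by (simp add: C_delta_x'_def)
    obtain U where U: "\<And>y. \<bar>u y\<bar> \<le> U"
      using ub by (auto simp: bounded_iff)
    have um: "u \<in> borel_measurable lebesgue"
      using W by (simp add: W22_loc_with_def L2_loc_def)
    have g1: "L2_loc (g1 j)" "weak_deriv1 j u (g1 j)" and g2: "\<And>i k. L2_loc (g2 i k)" "\<And>i k. weak_deriv2 i k u (g2 i k)"
      using W by (auto simp: W22_loc_with_def)
    have zero: "bump n b z = 0" if "r < norm z" for n z
      using bump_zero_outside[OF \<nu> b(3)] that by (simp add: r_def)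
    have test: "test_fun (bump n b)" for n
      using zero by (intro test_funI[of _ r] smooth_family_smooth[OF smooth_family_bump])
    obtain g G where
      g: "\<And>s x. 0 < s \<Longrightarrow> \<bar>s ^ (CARD('n) + 1) * mconv u (partial j (bump 2 b)) s x - g x\<bar>
        \<le> 2 * H * M * (measure lborel (ball (0 :: real^'n) 1) * r ^ CARD('n)) / (1 + \<delta>) * s powr (- 1 - \<delta>)"
      and dg: "\<And>x. (g has_derivative (\<lambda>h. \<Sum>i\<in>UNIV. h $ i * G i x)) (at x)"
      and G: "\<And>i x y. \<bar>G i x - G i y\<bar> \<le> (2 / \<delta> + ?d / (1 - \<delta>))
        * (2 * H * M * (measure lborel (ball (0 :: real^'n) 1) * r ^ CARD('n))) * norm (x - y) powr \<delta>"
      by (rule partial_schauder_core[OF um U fm F smooth_family_bump smooth_family_bump scaling_pair_bump[OF b(1,2)] r zero zero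
            mconv_elliptic[OF g2 eq um U fm] hoelder \<delta> M(2)[OF _ b(5,3)]]) blast+
    define c where "c = (LINT z|lebesgue. bump 2 b z)"
    have c: "c0 \<le> c" "0 < c"
      using bump_integral_lower_bound[OF \<nu> b(3,4)] c0 by (simp_all add: c_def c0_def)
    \<comment> \<open>Dividing by the mass turns the limit of the unnormalised mollifications into
      the derivative itself.\<close>
    define v where "v x = g x / c" for x
    have dv: "(v has_derivative (\<lambda>h. \<Sum>i\<in>UNIV. h $ i * (G i x / c))) (at x)" for x
      using has_derivative_mult_right[OF dg[of x], of "1 / c"] by (simp add: v_def[abs_def] sum_divide_distrib)
    have pv: "partial i v x = G i x / c" for i x
      unfolding partial_has_derivative[OF dv] using sum_axis[of 1 i "\<lambda>i. G i x / c"] by simp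
    have est: "\<bar>partial i v x - partial i v y\<bar> \<le> N * H * norm (x - y) powr \<delta>" for i x y
    proof -
      have "\<bar>partial i v x - partial i v y\<bar> = \<bar>G i x - G i y\<bar> / c"
        using c by (simp add: pv flip: diff_divide_distrib)
      also have "\<dots> \<le> (2 / \<delta> + ?d / (1 - \<delta>)) * (A * H) * norm (x - y) powr \<delta> / c"
        using G[of i x y] c by (intro divide_right_mono) (simp_all add: A_def mult_ac)
      also have "\<dots> \<le> (2 / \<delta> + ?d / (1 - \<delta>)) * (A * H) * norm (x - y) powr \<delta> / c0"
        using c c0 A H \<delta> by (intro divide_left_mono mult_nonneg_nonneg add_nonneg_nonneg) auto
      finally show ?thesis by (simp add: N_def mult_ac)
    qed
    have cont: "continuous_on UNIV (partial i v)" for i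
      unfolding continuous_on_eq_continuous_at[OF open_UNIV]
    proof
      fix x
      have "((\<lambda>y. partial i v y - partial i v x) \<longlongrightarrow> 0) (at x)"
      proof (rule Lim_null_comparison)
        show "\<forall>\<^sub>F y in at x. norm (partial i v y - partial i v x) \<le> N * H * norm (y - x) powr \<delta>"
          using est by (intro always_eventually) simp
        have "((\<lambda>y. N * H * norm (y - x) powr \<delta>) \<longlongrightarrow> N * H * norm (x - x) powr \<delta>) (at x)"
          using \<delta> by (intro tendsto_mult tendsto_const tendsto_powr' tendsto_norm tendsto_diff tendsto_ident_at) auto
        then show "((\<lambda>y. N * H * norm (y - x) powr \<delta>) \<longlongrightarrow> 0) (at x)" by simp
      qed
      then show "isCont (partial i v) x"
        unfolding isCont_def by (rule LIM_zero_cancel)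
    qed
    \<comment> \<open>Passing the j-th derivative from the kernel to \<open>u\<close> shows that the
      approximations of \<open>g\<close> are mollifications of \<open>g1 j\<close>.\<close>
    have "AE x in lebesgue. g x = c * g1 j x"
      unfolding c_def
    proof (rule mconv_limit_AE[OF g1(1) test])
      show "continuous_on UNIV g"
        using dg by (intro has_derivative_continuous_on) (auto intro: has_derivative_at_withinI)
      show "\<bar>real (Suc n) ^ CARD('n) * mconv (g1 j) (bump 2 b) (real (Suc n)) x - g x\<bar>
          \<le> 2 * H * M * (measure lborel (ball (0 :: real^'n) 1) * r ^ CARD('n)) / (1 + \<delta>) * real (Suc n) powr (- 1 - \<delta>)" for n x
      proof -
        have "real (Suc n) ^ (CARD('n) + 1) * mconv u (partial j (bump 2 b)) (real (Suc n)) x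
            = real (Suc n) ^ CARD('n) * mconv (g1 j) (bump 2 b) (real (Suc n)) x"
          by (subst mconv_weak_deriv1[OF g1(2) test, symmetric]) (simp_all add: mult_ac)
        then show ?thesis
          using g[of "real (Suc n)" x] by (simp only: of_nat_0_less_iff zero_less_Suc)
      qed
      have "(\<lambda>n. B * real (Suc n) powr (- 1 - \<delta>)) \<longlonglongrightarrow> B * 0" for B
        using \<delta> by (intro tendsto_mult tendsto_const tendsto_neg_powr
            filterlim_compose[OF filterlim_real_sequentially filterlim_Suc]) auto
      then show "(\<lambda>n. 2 * H * M * (measure lborel (ball (0 :: real^'n) 1) * r ^ CARD('n)) / (1 + \<delta>) * real (Suc n) powr (- 1 - \<delta>)) \<longlonglongrightarrow> 0"
        by (simp only: mult_zero_right)
    qed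
    then have "AE x in lebesgue. v x = g1 j x"
      by eventually_elim (use c in \<open>simp add: v_def\<close>)
    moreover have "v differentiable (at x)" for x
      using dv by (rule differentiableI)
    ultimately show ?thesis
      using cont est unfolding H_def by blast
  qed
  then show ?thesis
    by (intro exI[of _ N]) blast
qed

end
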